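(* Let $C$ be an $n$-computad. For every compatible tree $x\in\mathrm{Tree}_n^{\mathcal O,\mathcal E}(C)$ there exists a compatible tree $n(x)\in\mathrm{Tree}_n^{\mathcal O,\mathcal E}(C)$ in normal form such that $n(x)\sim x$.
   Context: Trees. Fix an integer $n\ge 0$. For an $n$-graded set $X=(X_0,\dots,X_n)$, the $n$-graded set $\mathrm{Tree}_n^{\mathcal O}(X)$ consists of formal terms (labelled rooted trees): each $c\in X_k$ is a tree of dimension $k$ (a leaf, height $0$); if $x$ is a tree of dimension $i-1$ ($1\le i\le n$) then $u_i(x)$ is a tree of dimension $i$; if $x,y$ are trees of dimensions $i,j$ ($1\le i,j\le n$) then $\circ_{i,j}(x,y)$ is a tree of dimension $\max\{i,j\}$. Internal vertices are labelled by the symbols $u_i$, $\circ_{i,j}$; edges point towards the root. Computads, compatible trees and the relation $\sim$ are defined by mutual induction on dimension. For $0\le k\le n$, a $k$-computad $C$ consists of sets $C_0,\dots,C_k$ (cells) and maps $s,t:C_i\to \mathrm{Tree}_n^{\mathcal O,\mathcal E}(C_{\le i-1})_{i-1}$ for $1\le i\le k$ (values are compatible trees) with $ss(x)\sim st(x)$ and $ts(x)\sim tt(x)$ for $x\in C_i$, $i\ge 2$. Here $C_{\leq i-1}$ is the underlying $(i-1)$-computad. Source and target are extended to $s,t:\mathrm{Tree}_n^{\mathcal O}(C)_i\to\mathrm{Tree}_n^{\mathcal O}(C)_{i-1}$ by $s(u_i(x))=t(u_i(x))=x$; $s(\circ_{i,i}(x,y))=s(y)$, $t(\circ_{i,i}(x,y))=t(x)$;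 and for $j<i$: $s(\circ_{j,i}(x,y))=\circ_{j,i-1}(x,s(y))$, $s(\circ_{i,j}(x,y))=\circ_{i-1,j}(s(x),y)$, and likewise with $t$ in place of $s$. Compatible trees: leaves are compatible; $u_i(x)$ is compatible iff $x$ is; $\circ_{i,j}(x,y)$ is compatible iff $x,y$ are and $s^{i-m+1}(x)\sim t^{j-m+1}(y)$ with $m=\min\{i,j\}$. $\mathrm{Tree}_n^{\mathcal O,\mathcal E}(C)$ is the set of compatible trees. The relation $\sim$ (written $\stackrel{\epsilon}{=}$ in the paper) is the smallest dimensionwise equivalence relation on compatible trees which is a congruence (if $x\sim\tilde x$ and $y\sim\tilde y$ then $u_i(x)\sim u_i(\tilde x)$ and $\circ_{i,j}(x,y)\sim\circ_{i,j}(\tilde x,\tilde y)$ whenever these are compatible) and contains the following, for all trees of appropriate dimensions whenever the left-hand side is compatible: for $i\le k$: $\circ_{i,k}(u_i(x),y)\sim y$; $\circ_{k,i}(x,u_i(y))\sim x$; for $i<k$: $\circ_{i,k}(x,u_k(y))\sim u_k(\circ_{i,k-1}(x,y))$; $\circ_{k,i}(u_k(x),y)\sim u_k(\circ_{k-1,i}(x,y))$; $\circ_{k,k}(\circ_{k,k}(x,y),z)\sim\circ_{k,k}(x,\circ_{k,k}(y,z))$; for $i<k$: $\circ_{i,k}(\circ_{i,i}(x,y),z)\sim\circ_{i,k}(x,\circ_{i,k}(y,z))$; $\circ_{k,i}(\circ_{i,k}(x,y),z)\sim\circ_{i,k}(x,\circ_{k,i}(y,z))$; $\circ_{k,i}(\circ_{k,i}(x,y),z)\sim\circ_{k,i}(x,\circ_{i,i}(y,z))$;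 $\circ_{i,k}(x,\circ_{k,k}(y,z))\sim\circ_{k,k}(\circ_{i,k}(x,y),\circ_{i,k}(x,z))$; $\circ_{k,i}(\circ_{k,k}(x,y),z)\sim\circ_{k,k}(\circ_{k,i}(x,z),\circ_{k,i}(y,z))$; for $i<j<k$: $\circ_{i,k}(x,\circ_{j,k}(y,z))\sim\circ_{j,k}(\circ_{i,j}(x,y),\circ_{i,k}(x,z))$; $\circ_{i,k}(x,\circ_{k,j}(y,z))\sim\circ_{k,j}(\circ_{i,k}(x,y),\circ_{i,j}(x,z))$; $\circ_{k,i}(\circ_{j,k}(x,y),z)\sim\circ_{j,k}(\circ_{j,i}(x,z),\circ_{k,i}(y,z))$; $\circ_{k,i}(\circ_{k,j}(x,y),z)\sim\circ_{k,j}(\circ_{k,i}(x,z),\circ_{j,i}(y,z))$. (Under these conditions both sides are compatible, and $s,t$ respect $\sim$.) Normal forms. For a vertex $v$ labelled $\circ_{i,j}$ put $m(v)=\min\{i,j\}$. A tree is $m$-ordered if $m(v)\le m(w)$ for every edge $v\to w$ (pointing towards the root) between $\circ$-labelled vertices. An $m$-constant component of a tree is a maximal connected set of $\circ$-labelled internal vertices such that $m(v)=m(w)$ for every edge $v\to w$ within it. An $m$-constant component is in normal form if it is either (1) for some $i<k$, a chain starting at its root with $a\geq 0$ vertices labelled $\circ_{i,k}$, followed by $b\ge 0$ vertices labelled $\circ_{k,i}$ ($a+b\ge1$), in which the next vertex is always attached at the right input of a $\circ_{i,k}$ vertex and at the left input of a $\circ_{k,i}$ vertex, i.e. of the shape $\circ_{i,k}(\cdot,\dots\circ_{i,k}(\cdot,\circ_{k,i}(\dots\circ_{k,i}(\cdot,\cdot)\dots,\cdot))\dots)$;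 or (2) a chain of $\circ_{k,k}$'s each attached at the left input of the previous one, $\circ_{k,k}(\dots\circ_{k,k}(\cdot,\cdot)\dots,\cdot)$. A tree is in normal form if it is $m$-ordered, contains no edge from a $u$-labelled vertex to a $\circ$-labelled vertex (i.e. no $u_i(\cdot)$ is a direct input of a $\circ$), and each of its $m$-constant components is in normal form. *)

theory Defs imports Main begin

text \<open>
  Formal terms over a graded set. The leaf \<open>Leaf k c\<close> carries its dimension \<open>k\<close>, so that the
  sets of cells of different dimensions need not be disjoint.
\<close>

datatype 'a tree =
    Leaf nat 'a
  | Ident nat "'a tree"                 \<comment> \<open>\<open>u\<^sub>i(x)\<close>\<close>
  | Comp nat nat "'a tree" "'a tree"    \<comment> \<open>\<open>\<circ>\<^sub>i\<^sub>,\<^sub>j(x, y)\<close>\<close>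

text \<open>\<open>is_tree n X d x\<close>: \<open>x\<close> is a tree of dimension \<open>d\<close> over the \<open>n\<close>-graded set \<open>X\<^sub>0, \<dots>, X\<^sub>n\<close>.\<close>

inductive is_tree :: "nat \<Rightarrow> (nat \<Rightarrow> 'a set) \<Rightarrow> nat \<Rightarrow> 'a tree \<Rightarrow> bool"
  for n :: nat and X :: "nat \<Rightarrow> 'a set" where
  leaf: "k \<le> n \<Longrightarrow> c \<in> X k \<Longrightarrow> is_tree n X k (Leaf k c)"
| ident: "1 \<le> i \<Longrightarrow> i \<le> n \<Longrightarrow> is_tree n X (i - 1) x \<Longrightarrow> is_tree n X i (Ident i x)"
| comp: "1 \<le> i \<Longrightarrow> i \<le> n \<Longrightarrow> 1 \<le> j \<Longrightarrow> j \<le> n \<Longrightarrow> is_tree n X i x \<Longrightarrow> is_tree n X j y \<Longrightarrow>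
    is_tree n X (max i j) (Comp i j x y)"


section \<open>Computads\<close>

text \<open>The values of \<open>cell_src\<close> and \<open>cell_tgt\<close> matter only on the cells of dimension at least 1.\<close>

record 'a precomputad =
  cells :: "nat \<Rightarrow> 'a set"
  cell_src :: "nat \<Rightarrow> 'a \<Rightarrow> 'a tree"
  cell_tgt :: "nat \<Rightarrow> 'a \<Rightarrow> 'a tree"

definition truncate :: "nat \<Rightarrow> 'a precomputad \<Rightarrow> 'a precomputad" where
  "truncate k C = C\<lparr>cells := (\<lambda>i. if i \<le> k then cells C i else {})\<rparr>"

text \<open>Source and target are meaningful on trees of dimension at least 1.\<close>

primrec src :: "'a precomputad \<Rightarrow> 'a tree \<Rightarrow> 'a tree" where
  "src C (Leaf k c) = cell_src C k c"
| "src C (Ident i x) = x"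
| "src C (Comp i j x y) =
    (if i = j then src C y
     else if i < j then Comp i (j - 1) x (src C y)
     else Comp (i - 1) j (src C x) y)"

primrec tgt :: "'a precomputad \<Rightarrow> 'a tree \<Rightarrow> 'a tree" where
  "tgt C (Leaf k c) = cell_tgt C k c"
| "tgt C (Ident i x) = x"
| "tgt C (Comp i j x y) =
    (if i = j then tgt C x
     else if i < j then Comp i (j - 1) x (tgt C y)
     else Comp (i - 1) j (tgt C x) y)"

text \<open>The generating instances of the relation \<open>\<sim>\<close>, oriented from left to right.\<close>

inductive basic_rel :: "'a tree \<Rightarrow> 'a tree \<Rightarrow> bool" where
  unit_left: "i \<le> k \<Longrightarrow> basic_rel (Comp i k (Ident i x) y) y"
| unit_right: "i \<le> k \<Longrightarrow> basic_rel (Comp k i x (Ident i y)) x"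
| ident_left: "i < k \<Longrightarrow>
    basic_rel (Comp i k x (Ident k y)) (Ident k (Comp i (k - 1) x y))"
| ident_right: "i < k \<Longrightarrow>
    basic_rel (Comp k i (Ident k x) y) (Ident k (Comp (k - 1) i x y))"
| assoc: "basic_rel (Comp k k (Comp k k x y) z) (Comp k k x (Comp k k y z))"
| assoc_left: "i < k \<Longrightarrow>
    basic_rel (Comp i k (Comp i i x y) z) (Comp i k x (Comp i k y z))"
| assoc_mid: "i < k \<Longrightarrow>
    basic_rel (Comp k i (Comp i k x y) z) (Comp i k x (Comp k i y z))"
| assoc_right: "i < k \<Longrightarrow>
    basic_rel (Comp k i (Comp k i x y) z) (Comp k i x (Comp i i y z))"
| distrib_left: "i < k \<Longrightarrow>
    basic_rel (Comp i k x (Comp k k y z)) (Comp k k (Comp i k x y) (Comp i k x z))"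
| distrib_right: "i < k \<Longrightarrow>
    basic_rel (Comp k i (Comp k k x y) z) (Comp k k (Comp k i x z) (Comp k i y z))"
| distrib_left1: "i < j \<Longrightarrow> j < k \<Longrightarrow>
    basic_rel (Comp i k x (Comp j k y z)) (Comp j k (Comp i j x y) (Comp i k x z))"
| distrib_left2: "i < j \<Longrightarrow> j < k \<Longrightarrow>
    basic_rel (Comp i k x (Comp k j y z)) (Comp k j (Comp i k x y) (Comp i j x z))"
| distrib_right1: "i < j \<Longrightarrow> j < k \<Longrightarrow>
    basic_rel (Comp k i (Comp j k x y) z) (Comp j k (Comp j i x z) (Comp k i y z))"
| distrib_right2: "i < j \<Longrightarrow> j < k \<Longrightarrow>
    basic_rel (Comp k i (Comp k j x y) z) (Comp k j (Comp k i x z) (Comp j i y z))"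

text \<open>
  \<open>compatible n C d x\<close>: \<open>x\<close> is a compatible tree of dimension \<open>d\<close>; \<open>equiv_tree n C d x y\<close>:
  \<open>x \<sim> y\<close> in dimension \<open>d\<close>. The recursion on dimension is expressed as a simultaneous inductive
  definition: compatibility in dimension \<open>d\<close> refers to \<open>\<sim>\<close> only in dimensions below \<open>d\<close>, and \<open>\<sim>\<close> in
  dimension \<open>d\<close> refers to compatibility and \<open>\<sim>\<close> only in dimensions up to \<open>d\<close>, so the least
  simultaneous solution is the one obtained dimension by dimension.
\<close>

inductive compatible :: "nat \<Rightarrow> 'a precomputad \<Rightarrow> nat \<Rightarrow> 'a tree \<Rightarrow> bool"
  and equiv_tree :: "nat \<Rightarrow> 'a precomputad \<Rightarrow> nat \<Rightarrow> 'a tree \<Rightarrow> 'a tree \<Rightarrow> bool"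
  for n :: nat and C :: "'a precomputad" where
  compatible_leaf:
    "is_tree n (cells C) d (Leaf k c) \<Longrightarrow> compatible n C d (Leaf k c)"
| compatible_ident:
    "is_tree n (cells C) d (Ident i x) \<Longrightarrow> compatible n C (i - 1) x \<Longrightarrow>
     compatible n C d (Ident i x)"
| compatible_comp:
    "is_tree n (cells C) d (Comp i j x y) \<Longrightarrow>
     compatible n C i x \<Longrightarrow> compatible n C j y \<Longrightarrow> m = min i j \<Longrightarrow>
     equiv_tree n C (m - 1) ((src C ^^ (i - m + 1)) x) ((tgt C ^^ (j - m + 1)) y) \<Longrightarrow>
     compatible n C d (Comp i j x y)"
| equiv_refl: "compatible n C d x \<Longrightarrow> equiv_tree n C d x x"
| equiv_sym: "equiv_tree n C d x y \<Longrightarrow> equiv_tree n C d y x"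
| equiv_trans: "equiv_tree n C d x y \<Longrightarrow> equiv_tree n C d y z \<Longrightarrow> equiv_tree n C d x z"
| cong_ident:
    "equiv_tree n C (i - 1) x x' \<Longrightarrow>
     compatible n C d (Ident i x) \<Longrightarrow> compatible n C d (Ident i x') \<Longrightarrow>
     equiv_tree n C d (Ident i x) (Ident i x')"
| cong_comp:
    "equiv_tree n C i x x' \<Longrightarrow> equiv_tree n C j y y' \<Longrightarrow>
     compatible n C d (Comp i j x y) \<Longrightarrow> compatible n C d (Comp i j x' y') \<Longrightarrow>
     equiv_tree n C d (Comp i j x y) (Comp i j x' y')"
| basic: "basic_rel x y \<Longrightarrow> compatible n C d x \<Longrightarrow> equiv_tree n C d x y"

text \<open>\<open>computad n k C\<close>: \<open>C\<close> is a \<open>k\<close>-computad, for \<open>k \<le> n\<close>.\<close>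

definition computad :: "nat \<Rightarrow> nat \<Rightarrow> 'a precomputad \<Rightarrow> bool" where
  "computad n k C \<longleftrightarrow>
    k \<le> n \<and> (\<forall>i>k. cells C i = {}) \<and>
    (\<forall>i c. 1 \<le> i \<and> i \<le> k \<and> c \<in> cells C i \<longrightarrow>
      (let D = truncate (i - 1) C; a = cell_src C i c; b = cell_tgt C i c in
        compatible n D (i - 1) a \<and> compatible n D (i - 1) b \<and>
        (2 \<le> i \<longrightarrow> equiv_tree n D (i - 2) (src D a) (src D b) \<and>
                  equiv_tree n D (i - 2) (tgt D a) (tgt D b))))"


section \<open>Normal forms\<close>

text \<open>
  A vertex is addressed by the path from the root of the tree to it; the input of an
  \<open>Ident\<close> vertex is its \<open>Lft\<close> input.
\<close>

datatype input = Lft | Rgt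

type_synonym vertex = "input list"

fun subtree_at :: "'a tree \<Rightarrow> vertex \<Rightarrow> 'a tree option" where
  "subtree_at x [] = Some x"
| "subtree_at (Ident i x) (Lft # p) = subtree_at x p"
| "subtree_at (Comp i j x y) (Lft # p) = subtree_at x p"
| "subtree_at (Comp i j x y) (Rgt # p) = subtree_at y p"
| "subtree_at _ _ = None"

definition u_vertex :: "'a tree \<Rightarrow> vertex \<Rightarrow> bool" where
  "u_vertex x v \<longleftrightarrow> (\<exists>i y. subtree_at x v = Some (Ident i y))"

definition comp_labelled :: "'a tree \<Rightarrow> vertex \<Rightarrow> nat \<Rightarrow> nat \<Rightarrow> bool" where
  "comp_labelled x v i j \<longleftrightarrow> (\<exists>y z. subtree_at x v = Some (Comp i j y z))"

definition comp_vertices :: "'a tree \<Rightarrow> vertex set" where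
  "comp_vertices x = {v. \<exists>i j. comp_labelled x v i j}"

text \<open>Meaningful on \<open>comp_vertices x\<close>.\<close>

definition m_val :: "'a tree \<Rightarrow> vertex \<Rightarrow> nat" where
  "m_val x v = (case subtree_at x v of Some (Comp i j y z) \<Rightarrow> min i j | _ \<Rightarrow> 0)"

text \<open>The edge \<open>v \<rightarrow> w\<close> points towards the root.\<close>

definition edge :: "vertex \<Rightarrow> vertex \<Rightarrow> bool" where
  "edge v w \<longleftrightarrow> (\<exists>d. v = w @ [d])"

definition m_ordered :: "'a tree \<Rightarrow> bool" where
  "m_ordered x \<longleftrightarrow>
    (\<forall>v\<in>comp_vertices x. \<forall>w\<in>comp_vertices x. edge v w \<longrightarrow> m_val x v \<le> m_val x w)"

definition connected_vertices :: "vertex set \<Rightarrow> bool" where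
  "connected_vertices S \<longleftrightarrow>
    S \<noteq> {} \<and>
    (\<forall>v\<in>S. \<forall>w\<in>S. (v, w) \<in> {(p, q). p \<in> S \<and> q \<in> S \<and> (edge p q \<or> edge q p)}\<^sup>*)"

definition m_constant :: "'a tree \<Rightarrow> vertex set \<Rightarrow> bool" where
  "m_constant x S \<longleftrightarrow>
    S \<subseteq> comp_vertices x \<and> connected_vertices S \<and>
    (\<forall>v\<in>S. \<forall>w\<in>S. edge v w \<longrightarrow> m_val x v = m_val x w)"

definition m_constant_component :: "'a tree \<Rightarrow> vertex set \<Rightarrow> bool" where
  "m_constant_component x S \<longleftrightarrow>
    m_constant x S \<and> (\<forall>T. m_constant x T \<and> S \<subseteq> T \<longrightarrow> T = S)"

text \<open>The list \<open>vs\<close> enumerates the chain starting from its root.\<close>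

definition whisker_chain :: "'a tree \<Rightarrow> vertex set \<Rightarrow> bool" where
  "whisker_chain x S \<longleftrightarrow>
    (\<exists>i k a b vs. i < k \<and> 1 \<le> a + b \<and> length vs = a + b \<and> S = set vs \<and>
      (\<forall>l<a. comp_labelled x (vs ! l) i k) \<and>
      (\<forall>l. a \<le> l \<and> l < a + b \<longrightarrow> comp_labelled x (vs ! l) k i) \<and>
      (\<forall>l. Suc l < a + b \<longrightarrow> vs ! Suc l = vs ! l @ [if l < a then Rgt else Lft]))"

definition left_chain :: "'a tree \<Rightarrow> vertex set \<Rightarrow> bool" where
  "left_chain x S \<longleftrightarrow>
    (\<exists>k vs. vs \<noteq> [] \<and> S = set vs \<and>
      (\<forall>v\<in>set vs. comp_labelled x v k k) \<and>
      (\<forall>l. Suc l < length vs \<longrightarrow> vs ! Suc l = vs ! l @ [Lft]))"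

definition normal_form :: "'a tree \<Rightarrow> bool" where
  "normal_form x \<longleftrightarrow>
    m_ordered x \<and>
    \<not> (\<exists>v w. edge v w \<and> u_vertex x v \<and> w \<in> comp_vertices x) \<and>
    (\<forall>S. m_constant_component x S \<longrightarrow> whisker_chain x S \<or> left_chain x S)"

end

theory Submission imports Defs begin

text \<open>
  In terms of the faces \<open>bd C s e x\<close> of \<open>x\<close> in dimension \<open>e\<close>, compatibility of \<open>\<circ>\<^sub>i\<^sub>,\<^sub>j(x, y)\<close> with
  \<open>m = min i j\<close> says that the source of \<open>x\<close> and the target of \<open>y\<close> in dimension \<open>m - 1\<close> are
  equivalent. By induction on the dimension, the faces of compatible trees are compatible and satisfy
  the globular identities up to \<open>\<sim>\<close>, and \<open>\<sim>\<close> relates only compatible trees and is respected by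
  faces. Hence generators can be applied to subtrees of compatible trees freely.

  To normalize \<open>\<circ>\<^sub>i\<^sub>,\<^sub>j(x, y)\<close> with \<open>x\<close> and \<open>y\<close> in normal form, one first pulls identities out. If
  \<open>i < j\<close>, distributivity pushes the composition below all vertices of \<open>y\<close> with \<open>m\<close>-value above
  \<open>i\<close>; this keeps the root label of \<open>y\<close>, so no new rewriting arises above. What remains are
  rearrangements by associativity inside one component. The case \<open>j < i\<close> is symmetric.
\<close>

section \<open>Iterated faces\<close>

primrec dim :: "'a tree \<Rightarrow> nat" where
  "dim (Leaf k c) = k"
| "dim (Ident i x) = i"
| "dim (Comp i j x y) = max i j"

lemma dim_eq: "is_tree n X d x \<Longrightarrow> dim x = d"
  by (induction rule: is_tree.induct) auto

text \<open>
  Sources are indexed by \<open>Rgt\<close> and targets by \<open>Lft\<close>, since \<open>\<circ>\<^sub>k\<^sub>,\<^sub>k(x, y)\<close> has the source of its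
  right and the target of its left input.
\<close>

primrec face :: "'a precomputad \<Rightarrow> input \<Rightarrow> 'a tree \<Rightarrow> 'a tree" where
  "face C Lft = tgt C"
| "face C Rgt = src C"

primrec cell_face :: "'a precomputad \<Rightarrow> input \<Rightarrow> nat \<Rightarrow> 'a \<Rightarrow> 'a tree" where
  "cell_face C Lft = cell_tgt C"
| "cell_face C Rgt = cell_src C"

primrec pick :: "input \<Rightarrow> 'b \<Rightarrow> 'b \<Rightarrow> 'b" where
  "pick Lft x y = x"
| "pick Rgt x y = y"

lemma face_simps [simp]:
  "face C s (Leaf k c) = cell_face C s k c"
  "face C s (Ident i x) = x"
  "face C s (Comp i j x y) =
    (if i = j then face C s (pick s x y)
     else if i < j then Comp i (j - 1) x (face C s y)
     else Comp (i - 1) j (face C s x) y)"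
  by (cases s; simp)+

text \<open>Faces are indexed by the dimension they land in, not by the number of steps, so that the
  matching condition of \<open>Comp i j x y\<close> sits in dimension \<open>min i j - 1\<close> for
  both inputs. Truncated subtraction makes \<open>bd\<close> the identity when \<open>e\<close> is
  at least \<open>dim x\<close>.\<close>

definition bd :: "'a precomputad \<Rightarrow> input \<Rightarrow> nat \<Rightarrow> 'a tree \<Rightarrow> 'a tree" where
  "bd C s e x = (face C s ^^ (dim x - e)) x"

lemma bd_ge [simp]: "dim x \<le> e \<Longrightarrow> bd C s e x = x"
  by (simp add: bd_def)

section \<open>Dimension rules for trees and passage from truncated computads\<close>

inductive_cases is_tree_LeafE: "is_tree n X d (Leaf k c)"
inductive_cases is_tree_IdentE: "is_tree n X d (Ident i x)"
inductive_cases is_tree_CompE: "is_tree n X d (Comp i j x y)"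

lemma is_tree_Leaf_iff: "is_tree n X d (Leaf k c) \<longleftrightarrow> d = k \<and> k \<le> n \<and> c \<in> X k"
  by (auto elim: is_tree_LeafE intro: is_tree.leaf)

lemma is_tree_Ident_iff:
  "is_tree n X d (Ident i x) \<longleftrightarrow> d = i \<and> 1 \<le> i \<and> i \<le> n \<and> is_tree n X (i - 1) x"
  by (auto elim: is_tree_IdentE intro: is_tree.ident)

lemma is_tree_Comp_iff:
  "is_tree n X d (Comp i j x y) \<longleftrightarrow> d = max i j \<and> 1 \<le> i \<and> i \<le> n \<and> 1 \<le> j \<and> j \<le> n \<and>
    is_tree n X i x \<and> is_tree n X j y"
  by (auto elim: is_tree_CompE intro: is_tree.comp)

lemmas is_tree_iff = is_tree_Leaf_iff is_tree_Ident_iff is_tree_Comp_iff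

lemma is_tree_mono: "is_tree n X d x \<Longrightarrow> (\<And>i. X i \<subseteq> Y i) \<Longrightarrow> is_tree n Y d x"
  by (induction rule: is_tree.induct) (auto intro: is_tree.intros)

lemma compatible_is_tree: "compatible n C d x \<Longrightarrow> is_tree n (cells C) d x"
  by (erule compatible.cases) auto

lemma src_truncate [simp]: "src (truncate k C) = src C"
proof
  show "src (truncate k C) x = src C x" for x
    by (induction x) (auto simp: truncate_def)
qed

lemma tgt_truncate [simp]: "tgt (truncate k C) = tgt C"
proof
  show "tgt (truncate k C) x = tgt C x" for x
    by (induction x) (auto simp: truncate_def)
qed

lemma is_tree_truncate: "is_tree n (cells (truncate k C)) d x \<Longrightarrow> is_tree n (cells C) d x"
  by (erule is_tree_mono) (auto simp: truncate_def)

text \<open>The boundary of a cell lives over a truncation. The rules depend on the computad only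
  through its cell sets, which grow here, and through \<open>src\<close> and \<open>tgt\<close>,
  which truncation does not change.\<close>

lemma
  compatible_truncate: "compatible n (truncate k C) d x \<Longrightarrow> compatible n C d x" and
  equiv_tree_truncate: "equiv_tree n (truncate k C) d x y \<Longrightarrow> equiv_tree n C d x y"
proof (induction rule: compatible_equiv_tree.inducts)
  case compatible_leaf
  then show ?case by (blast intro: compatible_equiv_tree.intros is_tree_truncate)
next
  case compatible_ident
  then show ?case by (blast intro: compatible_equiv_tree.intros is_tree_truncate)
next
  case (compatible_comp d i j x y m)
  then show ?case
    by (intro compatible_equiv_tree.compatible_comp) (auto intro: is_tree_truncate)
qed (blast intro: compatible_equiv_tree.intros)+

locale full_computad =
  fixes n :: nat and C :: "'a precomputad"
  assumes computad: "computad n n C"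
begin

abbreviation tree :: "nat \<Rightarrow> 'a tree \<Rightarrow> bool" where
  "tree \<equiv> is_tree n (cells C)"

abbreviation cmp :: "nat \<Rightarrow> 'a tree \<Rightarrow> bool" where
  "cmp \<equiv> compatible n C"

abbreviation eqv :: "nat \<Rightarrow> 'a tree \<Rightarrow> 'a tree \<Rightarrow> bool" where
  "eqv \<equiv> equiv_tree n C"

abbreviation fc :: "input \<Rightarrow> 'a tree \<Rightarrow> 'a tree" where
  "fc \<equiv> face C"

abbreviation bnd :: "input \<Rightarrow> nat \<Rightarrow> 'a tree \<Rightarrow> 'a tree" where
  "bnd \<equiv> bd C"

section \<open>Boundaries of trees and the matching condition\<close>

lemma cell_face_cmp:
  assumes "1 \<le> k" "c \<in> cells C k" "k \<le> n"
  shows "cmp (k - 1) (cell_face C s k c)"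
  using computad assms unfolding computad_def Let_def
  by (cases s) (auto dest: compatible_truncate)

text \<open>The computad condition compares a source with a target. The cases
  \<open>s' = s''\<close> go there and back by symmetry and transitivity, since reflexivity would
  require compatibility of these faces, which is not yet established.\<close>

lemma cell_face_globular:
  assumes "2 \<le> k" "c \<in> cells C k" "k \<le> n"
  shows "eqv (k - 2) (fc s (cell_face C s' k c)) (fc s (cell_face C s'' k c))"
proof -
  have "equiv_tree n (truncate (k - 1) C) (k - 2) (src C (cell_src C k c)) (src C (cell_tgt C k c))"
    "equiv_tree n (truncate (k - 1) C) (k - 2) (tgt C (cell_src C k c)) (tgt C (cell_tgt C k c))"
    using computad assms by (auto simp: computad_def Let_def)
  note st = this[THEN equiv_tree_truncate]
  note ts = st[THEN equiv_sym]
  note refl = equiv_trans[OF st(1) ts(1)] equiv_trans[OF st(2) ts(2)]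
    equiv_trans[OF ts(1) st(1)] equiv_trans[OF ts(2) st(2)]
  show ?thesis
    using st ts refl by (cases s; cases s'; cases s'') simp_all
qed

text \<open>Unless the indices agree, the strictly larger one is lowered, so it stays at least as
  large as the other and hence positive. Cells are handled by the compatibility of their
  boundaries.\<close>

lemma tree_fc: "tree d x \<Longrightarrow> 1 \<le> d \<Longrightarrow> tree (d - 1) (fc s x)"
proof (induction x arbitrary: d)
  case (Leaf k c)
  then show ?case using cell_face_cmp[of k c s] compatible_is_tree[of n C "k - 1"]
    by (auto simp: is_tree_iff)
next
  case (Comp i j x y)
  show ?case
  proof (cases i j rule: linorder_cases)
    case less
    then have "max i (j - 1) = d - 1" "1 \<le> i" "1 \<le> j - 1"
      using Comp.prems by (auto simp: is_tree_iff)
    then show ?thesis using Comp less by (auto simp: is_tree_iff)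
  next
    case equal
    then show ?thesis using Comp by (cases s) (auto simp: is_tree_iff)
  next
    case greater
    then have "max (i - 1) j = d - 1" "1 \<le> j" "1 \<le> i - 1"
      using Comp.prems by (auto simp: is_tree_iff)
    then show ?thesis using Comp greater by (auto simp: is_tree_iff)
  qed
qed (auto simp: is_tree_iff)

lemma bnd_step: "tree d x \<Longrightarrow> e < d \<Longrightarrow> bnd s e x = bnd s e (fc s x)"
proof -
  assume "tree d x" "e < d"
  then have "dim x = d" "dim (fc s x) = d - 1" "d - e = Suc (d - 1 - e)"
    using tree_fc[of d x s] by (auto simp: dim_eq)
  then show ?thesis by (simp only: bd_def funpow_Suc_right comp_apply)
qed

lemma bnd_pred: "tree d x \<Longrightarrow> 1 \<le> d \<Longrightarrow> bnd s (d - 1) x = fc s x"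
  by (simp add: bd_def dim_eq)

text \<open>Taking faces lowers the larger index until both agree; the next face keeps a single
  input, the right one for sources and the left one for targets. The induction follows the dimension
  of the composite, which drops with each face.\<close>

lemma bnd_Comp_less:
  "tree d (Comp i j x y) \<Longrightarrow> e < min i j \<Longrightarrow> bnd s e (Comp i j x y) = bnd s e (pick s x y)"
proof (induction d arbitrary: i j x y)
  case 0
  then show ?case by (auto simp: is_tree_iff)
next
  case (Suc d)
  have step: "bnd s e (Comp i j x y) = bnd s e (fc s (Comp i j x y))"
    using Suc.prems by (intro bnd_step[of "Suc d"]) (auto simp: is_tree_iff)
  have t: "tree d (fc s (Comp i j x y))"
    using tree_fc[OF Suc.prems(1)] by simp
  have xy: "tree i x" "tree j y" using Suc.prems by (auto simp: is_tree_iff)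
  show ?case
  proof (cases i j rule: linorder_cases)
    case less
    then have f: "fc s (Comp i j x y) = Comp i (j - 1) x (fc s y)" by simp
    have "bnd s e (Comp i (j - 1) x (fc s y)) = bnd s e (pick s x (fc s y))"
      using t less Suc.prems(2) unfolding f by (intro Suc.IH) auto
    moreover have "bnd s e (fc s y) = bnd s e y"
      using bnd_step[OF xy(2)] Suc.prems(2) by simp
    ultimately show ?thesis using step unfolding f by (cases s) auto
  next
    case equal
    then show ?thesis
      using step Suc.prems(2) bnd_step[OF xy(1), of e s] bnd_step[OF xy(2), of e s]
      by (cases s) auto
  next
    case greater
    then have f: "fc s (Comp i j x y) = Comp (i - 1) j (fc s x) y" by simp
    have "bnd s e (Comp (i - 1) j (fc s x) y) = bnd s e (pick s (fc s x) y)"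
      using t greater Suc.prems(2) unfolding f by (intro Suc.IH) auto
    moreover have "bnd s e (fc s x) = bnd s e x"
      using bnd_step[OF xy(1)] Suc.prems(2) by simp
    ultimately show ?thesis using step unfolding f by (cases s) auto
  qed
qed

text \<open>Down to dimension \<open>min i j\<close> the composition survives, and only inputs of
  dimension above \<open>e\<close> change. This is an equality of terms, not merely an
  equivalence.\<close>

lemma bnd_Comp_ge:
  "tree d (Comp i j x y) \<Longrightarrow> min i j \<le> e \<Longrightarrow>
    bnd s e (Comp i j x y) = Comp (min i e) (min j e) (bnd s e x) (bnd s e y)"
proof (induction d arbitrary: i j x y)
  case 0
  then show ?case by (auto simp: is_tree_iff)
next
  case (Suc d)
  have xy: "tree i x" "tree j y" and d: "max i j = Suc d"
    using Suc.prems by (auto simp: is_tree_iff)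
  have t: "tree d (fc s (Comp i j x y))"
    using tree_fc[OF Suc.prems(1)] by simp
  show ?case
  proof (cases "e < Suc d")
    case False
    then have "min i e = i" "min j e = j" "dim x \<le> e" "dim y \<le> e" "max i j \<le> e"
      using d xy by (auto simp: dim_eq)
    then show ?thesis by simp
  next
    case True
    have step: "bnd s e (Comp i j x y) = bnd s e (fc s (Comp i j x y))"
      using Suc.prems True by (intro bnd_step[of "Suc d"])
    show ?thesis
    proof (cases i j rule: linorder_cases)
      case less
      then have f: "fc s (Comp i j x y) = Comp i (j - 1) x (fc s y)" by simp
      have "bnd s e (Comp i (j - 1) x (fc s y)) =
          Comp (min i e) (min (j - 1) e) (bnd s e x) (bnd s e (fc s y))"
        using t less Suc.prems(2) unfolding f by (intro Suc.IH) auto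
      moreover have "bnd s e (fc s y) = bnd s e y" "min (j - 1) e = min j e"
        using bnd_step[OF xy(2), of e s] less True d by auto
      ultimately show ?thesis using step unfolding f by simp
    next
      case equal
      then show ?thesis using Suc.prems(2) True d by simp
    next
      case greater
      then have f: "fc s (Comp i j x y) = Comp (i - 1) j (fc s x) y" by simp
      have "bnd s e (Comp (i - 1) j (fc s x) y) =
          Comp (min (i - 1) e) (min j e) (bnd s e (fc s x)) (bnd s e y)"
        using t greater Suc.prems(2) unfolding f by (intro Suc.IH) auto
      moreover have "bnd s e (fc s x) = bnd s e x" "min (i - 1) e = min i e"
        using bnd_step[OF xy(1), of e s] greater True d by auto
      ultimately show ?thesis using step unfolding f by simp
    qed
  qed
qed

lemma cmp_Ident_iff: "cmp d (Ident i x) \<longleftrightarrow> d = i \<and> 1 \<le> i \<and> i \<le> n \<and> cmp (i - 1) x"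
proof
  assume "cmp d (Ident i x)"
  then show "d = i \<and> 1 \<le> i \<and> i \<le> n \<and> cmp (i - 1) x"
    by cases (auto simp: is_tree_iff)
qed (auto intro!: compatible_ident simp: is_tree_iff compatible_is_tree)

text \<open>The definition counts \<open>i - m + 1\<close> and \<open>j - m + 1\<close> steps; as
  \<open>m\<close> is positive, these are exactly the steps down to dimension
  \<open>m - 1\<close>.\<close>

lemma cmp_Comp_iff:
  "cmp d (Comp i j x y) \<longleftrightarrow> d = max i j \<and> 1 \<le> i \<and> i \<le> n \<and> 1 \<le> j \<and> j \<le> n \<and> cmp i x \<and> cmp j y \<and>
    eqv (min i j - 1) (bnd Rgt (min i j - 1) x) (bnd Lft (min i j - 1) y)" (is "?L \<longleftrightarrow> ?R")
proof
  assume ?L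
  then show ?R
  proof cases
    case (compatible_comp m)
    then have *: "dim x = i" "dim y = j" "i - m + 1 = i - (m - 1)" "j - m + 1 = j - (m - 1)"
      by (auto simp: is_tree_iff dim_eq)
    have "eqv (m - 1) (bnd Rgt (m - 1) x) (bnd Lft (m - 1) y)"
      unfolding bd_def face.simps *(1,2) *(3,4)[symmetric] by (fact compatible_comp)
    with compatible_comp show ?thesis by (simp add: is_tree_iff)
  qed
next
  assume R: ?R
  then have t: "tree i x" "tree j y" by (auto intro: compatible_is_tree)
  then have "dim x = i" "dim y = j" by (auto simp: dim_eq)
  moreover have "i - min i j + 1 = i - (min i j - 1)" "j - min i j + 1 = j - (min i j - 1)"
    using R by auto
  ultimately have "eqv (min i j - 1) ((src C ^^ (i - min i j + 1)) x) ((tgt C ^^ (j - min i j + 1)) y)"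
    using R by (simp only: bd_def face.simps)
  then show ?L
    using R t by (intro compatible_comp[OF _ _ _ refl]) (simp_all add: is_tree_iff)
qed

end

text \<open>Equal pairwise minima force at least two of \<open>a\<close>, \<open>b\<close>,
  \<open>c\<close> to equal \<open>m\<close>. The four possibilities are the generator
  \<open>assoc\<close> and its three whiskered variants.\<close>

lemma basic_rel_assoc:
  assumes "min a b = m" "min b c = m" "min a c = m"
  shows "basic_rel (Comp (max a b) c (Comp a b x y) z) (Comp a (max b c) x (Comp b c y z))"
proof -
  consider "a = m" "b = m" "c = m" | "a = m" "b = m" "m < c" | "a = m" "m < b" "c = m"
    | "m < a" "b = m" "c = m"
    using assms by (cases "a = m"; cases "b = m"; cases "c = m") (auto simp: min_def split: if_splits)
  then show ?thesis by cases (simp_all add: basic_rel.intros max_def)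
qed

text \<open>The three left distributivity generators are the cases \<open>a < b\<close>,
  \<open>a = b\<close> and \<open>a > b\<close>.\<close>

lemma basic_rel_distrib_left:
  "i < min a b \<Longrightarrow>
    basic_rel (Comp i (max a b) x (Comp a b y z)) (Comp a b (Comp i a x y) (Comp i b x z))"
  by (cases a b rule: linorder_cases) (simp_all add: max_def basic_rel.intros)

lemma basic_rel_distrib_right:
  "i < min a b \<Longrightarrow>
    basic_rel (Comp (max a b) i (Comp a b x y) z) (Comp a b (Comp a i x z) (Comp b i y z))"
  by (cases a b rule: linorder_cases) (simp_all add: max_def basic_rel.intros)

text \<open>The last ten generators are instances of one associativity law and two distributivity laws.\<close>

lemma basic_rel_cases [consumes 1, case_names unit_left unit_right ident_left ident_right
    assoc distrib_left distrib_right]: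
  assumes "basic_rel t u"
  obtains i k x y where "i \<le> k" "t = Comp i k (Ident i x) y" "u = y"
  | i k x y where "i \<le> k" "t = Comp k i x (Ident i y)" "u = x"
  | i k x y where "i < k" "t = Comp i k x (Ident k y)" "u = Ident k (Comp i (k - 1) x y)"
  | i k x y where "i < k" "t = Comp k i (Ident k x) y" "u = Ident k (Comp (k - 1) i x y)"
  | a b c m x y z where "min a b = m" "min b c = m" "min a c = m"
      "t = Comp (max a b) c (Comp a b x y) z" "u = Comp a (max b c) x (Comp b c y z)"
  | i a b x y z where "i < min a b" "t = Comp i (max a b) x (Comp a b y z)"
      "u = Comp a b (Comp i a x y) (Comp i b x z)"
  | i a b x y z where "i < min a b" "t = Comp (max a b) i (Comp a b x y) z"
      "u = Comp a b (Comp a i x z) (Comp b i y z)"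
  using assms
proof cases
  case (assoc k x y z)
  then show thesis using that(5)[of k k k k x y z] by simp
next
  case (assoc_left i k x y z)
  then show thesis using that(5)[of i i i k x y z] by simp
next
  case (assoc_mid i k x y z)
  then show thesis using that(5)[of i k i i x y z] by simp
next
  case (assoc_right i k x y z)
  then show thesis using that(5)[of k i i i x y z] by simp
next
  case (distrib_left i k x y z)
  then show thesis using that(6)[of i k k x y z] by simp
next
  case (distrib_left1 i j k x y z)
  then show thesis using that(6)[of i j k x y z] by simp
next
  case (distrib_left2 i j k x y z)
  then show thesis using that(6)[of i k j x y z] by simp
next
  case (distrib_right i k x y z)
  then show thesis using that(7)[of i k k x y z] by simp
next
  case (distrib_right1 i j k x y z)
  then show thesis using that(7)[of i j k x y z] by simp
next
  case (distrib_right2 i j k x y z)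
  then show thesis using that(7)[of i k j x y z] by simp
next
  case (unit_left i k x)
  then show thesis using that(1) by simp
next
  case (unit_right i k y)
  then show thesis using that(2) by simp
next
  case (ident_left i k x y)
  then show thesis using that(3) by simp
next
  case (ident_right i k x y)
  then show thesis using that(4) by simp
qed

text \<open>A face turns a generator into an instance of the same law or into the same term on both
  sides. The exception is a unit law with equal indices when the face falls on the identity: there
  the two faces are related only through compatibility of the composite.\<close>

lemma basic_rel_face:
  assumes "basic_rel t u"
  shows "face C s t = face C s u \<or> basic_rel (face C s t) (face C s u) \<or>
    (\<exists>k x y. t = Comp k k (Ident k x) y \<and> u = y \<and> s = Lft) \<or>
    (\<exists>k x y. t = Comp k k x (Ident k y) \<and> u = x \<and> s = Rgt)"
  using assms
proof (cases rule: basic_rel_cases)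
  case (unit_left i k x y)
  then have "i \<le> k - 1" if "i \<noteq> k" using that by simp
  with unit_left show ?thesis by (cases s) (auto intro: basic_rel.unit_left)
next
  case (unit_right i k x y)
  then have "i \<le> k - 1" if "i \<noteq> k" using that by simp
  with unit_right show ?thesis by (cases s) (auto intro: basic_rel.unit_right)
next
  case (assoc a b c m x y z)
  then consider "a = m" "b = m" "c = m" | "a = m" "b = m" "m < c" | "a = m" "m < b" "c = m"
    | "m < a" "b = m" "c = m"
    by (cases "a = m"; cases "b = m"; cases "c = m") (auto simp: min_def split: if_splits)
  then show ?thesis
  proof cases
    case 1
    with assoc show ?thesis by (cases s) auto
  next
    case 2
    then have "max m (c - 1) = c - 1" "max m c = c" "min m (c - 1) = m" by auto
    with assoc 2 basic_rel_assoc[of m m m "c - 1" x y "face C s z"] show ?thesis by simp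
  next
    case 3
    then have "max m (b - 1) = b - 1" "max (b - 1) m = b - 1" "max m b = b" "max b m = b"
      "min m (b - 1) = m" "min (b - 1) m = m" by auto
    with assoc 3 basic_rel_assoc[of m "b - 1" m m x "face C s y" z] show ?thesis by simp
  next
    case 4
    then have "max (a - 1) m = a - 1" "max a m = a" "min (a - 1) m = m" by auto
    with assoc 4 basic_rel_assoc[of "a - 1" m m m "face C s x" y z] show ?thesis by simp
  qed
next
  case (distrib_left i a b x y z)
  then have i: "i < a" "i < b" by auto
  \<comment> \<open>The larger of \<open>a\<close> and \<open>b\<close> drops and stays above
    \<open>i\<close>, so the law applies again. For \<open>a = b\<close> both faces are the same
    whiskering of a face of one input.\<close>
  show ?thesis
  proof (cases a b rule: linorder_cases)
    case less
    then have m: "max a b = b" "max a (b - 1) = b - 1" "i < min a (b - 1)"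
      using i by auto
    have "face C s t = Comp i (b - 1) x (Comp a (b - 1) y (face C s z))"
      "face C s u = Comp a (b - 1) (Comp i a x y) (Comp i (b - 1) x (face C s z))"
      unfolding distrib_left(2,3) m(1) using less i by simp_all
    then show ?thesis
      using basic_rel_distrib_left[OF m(3), of x y "face C s z"] unfolding m(2) by simp
  next
    case equal
    have "face C s t = face C s u"
      unfolding distrib_left(2,3) equal max.idem using i by (cases s) simp_all
    then show ?thesis by simp
  next
    case greater
    then have m: "max a b = a" "max (a - 1) b = a - 1" "i < min (a - 1) b"
      using i by auto
    have "face C s t = Comp i (a - 1) x (Comp (a - 1) b (face C s y) z)"
      "face C s u = Comp (a - 1) b (Comp i (a - 1) x (face C s y)) (Comp i b x z)"
      unfolding distrib_left(2,3) m(1) using greater i by simp_all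
    then show ?thesis
      using basic_rel_distrib_left[OF m(3), of x "face C s y" z] unfolding m(2) by simp
  qed
next
  case (distrib_right i a b x y z)
  then have i: "i < a" "i < b" by auto
  show ?thesis
  proof (cases a b rule: linorder_cases)
    case less
    then have m: "max a b = b" "max a (b - 1) = b - 1" "i < min a (b - 1)"
      using i by auto
    have "face C s t = Comp (b - 1) i (Comp a (b - 1) x (face C s y)) z"
      "face C s u = Comp a (b - 1) (Comp a i x z) (Comp (b - 1) i (face C s y) z)"
      unfolding distrib_right(2,3) m(1) using less i by simp_all
    then show ?thesis
      using basic_rel_distrib_right[OF m(3), of x "face C s y" z] unfolding m(2) by simp
  next
    case equal
    have "face C s t = face C s u"
      unfolding distrib_right(2,3) equal max.idem using i by (cases s) simp_all
    then show ?thesis by simp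
  next
    case greater
    then have m: "max a b = a" "max (a - 1) b = a - 1" "i < min (a - 1) b"
      using i by auto
    have "face C s t = Comp (a - 1) i (Comp (a - 1) b (face C s x) y) z"
      "face C s u = Comp (a - 1) b (Comp (a - 1) i (face C s x) z) (Comp b i y z)"
      unfolding distrib_right(2,3) m(1) using greater i by simp_all
    then show ?thesis
      using basic_rel_distrib_right[OF m(3), of "face C s x" y z] unfolding m(2) by simp
  qed
next
  case (ident_left i k x y)
  then show ?thesis by simp
next
  case (ident_right i k x y)
  then show ?thesis by simp
qed

section \<open>Mutual induction on the dimension for faces and equivalence\<close>

context full_computad begin

text \<open>The dimension \<open>min e d\<close> also covers \<open>e \<ge> d\<close>, where
  \<open>bnd\<close> does nothing. The second clause is the globular identity in every codimension:
  an intermediate face of either kind is invisible in lower dimensions.\<close>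

definition globular :: "nat \<Rightarrow> bool" where
  "globular d \<longleftrightarrow> (\<forall>x. cmp d x \<longrightarrow> (\<forall>s e. cmp (min e d) (bnd s e x)) \<and>
    (\<forall>s s' e f. e < f \<longrightarrow> eqv (min e d) (bnd s e (bnd s' f x)) (bnd s e x)))"

definition invariant :: "nat \<Rightarrow> bool" where
  "invariant d \<longleftrightarrow> (\<forall>x y. eqv d x y \<longrightarrow> cmp d x \<and> cmp d y \<and>
    (\<forall>s e. eqv (min e d) (bnd s e x) (bnd s e y)))"

lemma globular_cmp: "globular d \<Longrightarrow> cmp d x \<Longrightarrow> cmp (min e d) (bnd s e x)"
  unfolding globular_def by blast

lemma globular_eqv:
  "globular d \<Longrightarrow> cmp d x \<Longrightarrow> e < f \<Longrightarrow> eqv (min e d) (bnd s e (bnd s' f x)) (bnd s e x)"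
  unfolding globular_def by blast

lemma invariant_cmp: "invariant d \<Longrightarrow> eqv d x y \<Longrightarrow> cmp d x \<and> cmp d y"
  unfolding invariant_def by blast

lemma invariant_eqv: "invariant d \<Longrightarrow> eqv d x y \<Longrightarrow> eqv (min e d) (bnd s e x) (bnd s e y)"
  unfolding invariant_def by blast

lemma bnd_self: "cmp d x \<Longrightarrow> d \<le> e \<Longrightarrow> bnd s e x = x"
  using dim_eq[OF compatible_is_tree, of n C d x] by simp

lemma cmp_tree: "cmp d x \<Longrightarrow> tree d x"
  by (rule compatible_is_tree)

text \<open>By induction on the tree. A leaf passes the question to its boundary, one dimension
  lower; a composite uses its matching condition, an equivalence of lower dimension and hence
  respected by faces.\<close>

lemma globular_step:
  assumes lower: "\<And>e. e < d \<Longrightarrow> globular e" "\<And>e. e < d \<Longrightarrow> invariant e"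
  shows "globular d"
proof -
  \<comment> \<open>Dimensions below \<open>d\<close> are included so that the induction reaches
    both inputs of a composite, of which only one need have full dimension.\<close>
  have "(\<forall>s e. cmp (min e d') (bnd s e x)) \<and>
      (\<forall>s s' e f. e < f \<longrightarrow> eqv (min e d') (bnd s e (bnd s' f x)) (bnd s e x))"
    if "cmp d' x" "d' \<le> d" for x d'
    using that
  proof (induction x arbitrary: d' rule: tree.induct)
    case (Leaf k c)
    have t: "tree k (Leaf k c)" and k: "d' = k" "c \<in> cells C k" "k \<le> n"
      using cmp_tree[OF Leaf.prems(1)] by (auto simp: is_tree_iff)
    have face: "cmp (k - 1) (cell_face C s k c)" "bnd s e (Leaf k c) = bnd s e (cell_face C s k c)"
      if "e < k" for s e
      using that bnd_step[OF t that] cell_face_cmp[of k c] k by auto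
    have "cmp (min e k) (bnd s e (Leaf k c))" for s e
    proof (cases "e < k")
      case True
      then have "min e (k - 1) = e" "min e k = e" "k - 1 < d" using Leaf k by auto
      then show ?thesis
        using face[OF True, of s] globular_cmp[OF lower(1)[of "k - 1"], of "cell_face C s k c" e s]
        by simp
    next
      case False
      then show ?thesis using Leaf k by (simp add: min_def)
    qed
    moreover have "eqv (min e k) (bnd s e (bnd s' f (Leaf k c))) (bnd s e (Leaf k c))"
      if "e < f" for s s' e f
    proof (cases "f < k")
      case False
      have "cmp (min e k) (bnd s e (Leaf k c))" by fact
      with False show ?thesis by (simp add: equiv_refl)
    next
      case True
      have mins: "min e (k - 1) = e" "min e k = e" "k - 1 < d" "min e (k - 2) = e" "k - 2 < d"
        "e < k" "e < k - 1"
        using True that Leaf k by auto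
      have "eqv e (bnd s e (bnd s' f (Leaf k c))) (bnd s e (cell_face C s' k c))"
        using face[OF True, of s'] mins that
          globular_eqv[OF lower(1)[of "k - 1"], of "cell_face C s' k c" e f s s']
        by simp
      \<comment> \<open>Changing the boundary from \<open>s'\<close> to \<open>s\<close> uses the
        computad condition in dimension \<open>k - 2\<close>; \<open>invariant\<close> then carries
        it down to dimension \<open>e\<close>.\<close>
      moreover have "eqv e (bnd s e (cell_face C s' k c)) (bnd s e (Leaf k c))"
      proof -
        have tr: "tree (k - 1) (cell_face C u k c)" for u
          using face(1)[OF mins(6)] cmp_tree by simp
        have *: "bnd s e (cell_face C u k c) = bnd s e (fc s (cell_face C u k c))" for u
          using bnd_step[OF tr] mins by simp
        have "eqv (k - 2) (fc s (cell_face C s' k c)) (fc s (cell_face C s k c))"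
          using k True that by (intro cell_face_globular) auto
        then have "eqv (min e (k - 2)) (bnd s e (fc s (cell_face C s' k c)))
            (bnd s e (fc s (cell_face C s k c)))"
          using lower(2)[OF mins(5)] invariant_eqv by simp
        then show ?thesis
          using * face(2)[OF mins(6)] mins by simp
      qed
      ultimately show ?thesis using mins by (auto intro: equiv_trans)
    qed
    ultimately show ?case using k by simp
  next
    case (Ident i x)
    then have i: "d' = i" "1 \<le> i" "i \<le> n" "cmp (i - 1) x" and t: "tree i (Ident i x)"
      using cmp_tree[of i] by (auto simp: cmp_Ident_iff)
    have IH: "cmp (min e (i - 1)) (bnd s e x)"
      "e < f \<Longrightarrow> eqv (min e (i - 1)) (bnd s e (bnd s' f x)) (bnd s e x)" for s s' e f
      using Ident.IH[OF i(4)] Ident.prems i by auto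
    have b: "bnd s e (Ident i x) = (if e < i then bnd s e x else Ident i x)" for s e
      using bnd_step[OF t] by auto
    have "min e (i - 1) = min e i" if "e < i" for e using that by auto
    then have A: "cmp (min e i) (bnd s e (Ident i x))" for s e
      using IH(1)[of e s] Ident.prems i b by (cases "e < i") auto
    have "eqv (min e i) (bnd s e (bnd s' f (Ident i x))) (bnd s e (Ident i x))"
      if "e < f" for s s' e f
    proof (cases "f < i")
      case True
      then have "min e (i - 1) = e" "min e i = e" using that by auto
      then show ?thesis using IH(2)[OF that] True that b by simp
    next
      case False
      then show ?thesis using A[of e s] b by (simp add: equiv_refl)
    qed
    with A show ?case using i by simp
  next
    case (Comp i j x y)
    define m where "m = min i j"
    have c: "cmp i x" "cmp j y" "1 \<le> i" "1 \<le> j" "i \<le> n" "j \<le> n" "d' = max i j"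
      and xy: "eqv (m - 1) (bnd Rgt (m - 1) x) (bnd Lft (m - 1) y)"
      using Comp.prems by (auto simp: cmp_Comp_iff m_def)
    note t = cmp_tree[OF Comp.prems(1)]
    have le: "i \<le> d" "j \<le> d" using c Comp.prems by auto
    have Ax: "cmp (min e i) (bnd s e x)" and Ay: "cmp (min e j) (bnd s e y)" for s e
      using Comp.IH(1)[OF c(1) le(1)] Comp.IH(2)[OF c(2) le(2)] by blast+
    have Bx: "eqv (min e i) (bnd s e (bnd s' f x)) (bnd s e x)"
      and By: "eqv (min e j) (bnd s e (bnd s' f y)) (bnd s e y)" if "e < f" for s s' e f
      using Comp.IH(1)[OF c(1) le(1)] Comp.IH(2)[OF c(2) le(2)] that by blast+
    have A: "cmp (min e d') (bnd s e (Comp i j x y))" for s e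
    proof (cases "e < m")
      case True
      then have "min e d' = min e i" "min e d' = min e j" using c by (auto simp: m_def)
      then show ?thesis
        using bnd_Comp_less[OF t, of e s] True Ax[of e s] Ay[of e s] unfolding m_def
        by (cases s) simp_all
    next
      case False
      then have e: "m \<le> e" "m - 1 < e" "min (m - 1) i = m - 1" "min (m - 1) j = m - 1"
        using c by (auto simp: m_def)
      \<comment> \<open>Faces of dimension at least \<open>m\<close> do not affect faces in
        dimension \<open>m - 1\<close>, so the matching condition passes from the inputs to their
        faces.\<close>
      have "eqv (m - 1) (bnd Rgt (m - 1) (bnd s e x)) (bnd Rgt (m - 1) x)"
        "eqv (m - 1) (bnd Lft (m - 1) (bnd s e y)) (bnd Lft (m - 1) y)"
        using Bx[OF e(2), of Rgt] By[OF e(2), of Lft] e by simp_all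
      with xy have "eqv (m - 1) (bnd Rgt (m - 1) (bnd s e x)) (bnd Lft (m - 1) (bnd s e y))"
        by (meson equiv_trans equiv_sym)
      moreover have "min (min i e) (min j e) - 1 = m - 1" using e by (auto simp: m_def)
      moreover have "min e d' = max (min i e) (min j e)" using c by auto
      moreover have "cmp (min i e) (bnd s e x)" "cmp (min j e) (bnd s e y)"
        using Ax Ay by (simp_all add: min.commute)
      moreover have "1 \<le> min i e" "min i e \<le> n" "1 \<le> min j e" "min j e \<le> n"
        using c e(1) by (auto simp: m_def)
      moreover have "bnd s e (Comp i j x y) = Comp (min i e) (min j e) (bnd s e x) (bnd s e y)"
        using e(1) unfolding m_def by (rule bnd_Comp_ge[OF t])
      ultimately show ?thesis by (simp only: cmp_Comp_iff simp_thms)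
    qed
    have B: "eqv (min e d') (bnd s e (bnd s' f (Comp i j x y))) (bnd s e (Comp i j x y))"
      if "e < f" for s s' e f
    proof (cases "f < d'")
      case False
      then have "bnd s' f (Comp i j x y) = Comp i j x y"
        by (intro bnd_self[OF Comp.prems(1)]) simp
      then show ?thesis using A[of e s] by (simp only: equiv_refl)
    next
      case f: True
      have min: "min e d' = e" using f that by simp
      note tf = cmp_tree[OF A[of f s']]
      \<comment> \<open>The cases record whether the faces in dimensions \<open>e\<close> and
        \<open>f\<close> are still composites or already faces of a single input. In the last case
        \<open>s\<close> and \<open>s'\<close> may select different inputs.\<close>
      consider "m \<le> e" | "e < m" "m \<le> f" | "f < m" using that by linarith
      then show ?thesis
      proof cases
        case 1
        have bf: "bnd s' f (Comp i j x y) = Comp (min i f) (min j f) (bnd s' f x) (bnd s' f y)"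
          using 1 that unfolding m_def by (intro bnd_Comp_ge[OF t]) auto
        have be: "bnd s e (Comp i j x y) = Comp (min i e) (min j e) (bnd s e x) (bnd s e y)"
          using 1 unfolding m_def by (intro bnd_Comp_ge[OF t]) auto
        have "min (min i f) (min j f) \<le> e" "min (min i f) e = min i e" "min (min j f) e = min j e"
          using 1 that by (auto simp: m_def)
        then have bef: "bnd s e (bnd s' f (Comp i j x y)) =
            Comp (min i e) (min j e) (bnd s e (bnd s' f x)) (bnd s e (bnd s' f y))"
          using bnd_Comp_ge[OF tf[unfolded bf], of e s] unfolding bf by simp
        have "eqv (min i e) (bnd s e (bnd s' f x)) (bnd s e x)"
          "eqv (min j e) (bnd s e (bnd s' f y)) (bnd s e y)"
          using Bx[OF that] By[OF that] by (simp_all add: min.commute)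
        moreover have "cmp e (bnd s e (bnd s' f (Comp i j x y)))"
          using globular_cmp[OF lower(1) A[of f s'], of e s] f that Comp.prems by simp
        moreover have "cmp e (bnd s e (Comp i j x y))" using A[of e s] min by simp
        ultimately show ?thesis
          unfolding min bef be by (intro cong_comp)
      next
        case 2
        have bf: "bnd s' f (Comp i j x y) = Comp (min i f) (min j f) (bnd s' f x) (bnd s' f y)"
          using bnd_Comp_ge[OF t, of f s'] 2 by (simp add: m_def)
        have be: "bnd s e (Comp i j x y) = bnd s e (pick s x y)"
          using bnd_Comp_less[OF t, of e s] 2 by (simp add: m_def)
        have "bnd s e (bnd s' f (Comp i j x y)) = bnd s e (pick s (bnd s' f x) (bnd s' f y))"
          using bnd_Comp_less[OF tf[unfolded bf], of e s] bf 2 that by (auto simp: m_def)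
        moreover have "min e i = e" "min e j = e" using 2 by (auto simp: m_def)
        ultimately show ?thesis
          using be min Bx[OF that, of s s'] By[OF that, of s s'] by (cases s) simp_all
      next
        case 3
        have bf: "bnd s' f (Comp i j x y) = bnd s' f (pick s' x y)"
          using bnd_Comp_less[OF t, of f s'] 3 by (simp add: m_def)
        have be: "bnd s e (Comp i j x y) = bnd s e (pick s x y)"
          using bnd_Comp_less[OF t, of e s] 3 that by (simp add: m_def)
        have mins: "min e i = e" "min e j = e" "min e (m - 1) = e" "e < m - 1" "m - 1 < d"
          using 3 that c le by (auto simp: m_def)
        have b1: "eqv e (bnd s e (bnd s' f (pick s' x y))) (bnd s e (pick s' x y))"
          using Bx[OF that, of s s'] By[OF that, of s s'] mins by (cases s') simp_all
        \<comment> \<open>The matching condition lies in dimension \<open>m - 1\<close>, strictly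
          above \<open>e\<close>; its \<open>e\<close>-face relates the \<open>e\<close>-faces of
          both inputs, so the selected input does not matter.\<close>
        have "eqv e (bnd s e (bnd Rgt (m - 1) x)) (bnd s e (bnd Lft (m - 1) y))"
          using invariant_eqv[OF lower(2) xy, of e s] mins by simp
        moreover have "eqv e (bnd s e (bnd Rgt (m - 1) x)) (bnd s e x)"
          "eqv e (bnd s e (bnd Lft (m - 1) y)) (bnd s e y)"
          using Bx[OF mins(4), of s] By[OF mins(4), of s] mins by simp_all
        ultimately have "eqv e (bnd s e x) (bnd s e y)" by (meson equiv_trans equiv_sym)
        moreover from this have "eqv e (bnd s e x) (bnd s e x)" "eqv e (bnd s e y) (bnd s e y)"
          by (meson equiv_trans equiv_sym)+
        ultimately have "eqv e (bnd s e (pick s' x y)) (bnd s e (pick s x y))"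
          by (cases s; cases s') (auto intro: equiv_sym)
        then show ?thesis using b1 bf be min by (auto intro: equiv_trans)
      qed
    qed
    from A B show ?case by blast
  qed
  then show ?thesis unfolding globular_def by blast
qed

text \<open>From dimension \<open>i\<close> upwards a face leaves the whisker \<open>x\<close>
  alone, so congruence applies. This supplies the matching condition between the two whiskered
  factors that distributivity produces.\<close>

lemma faces_cong_right:
  assumes "globular j" "globular k" "cmp j (Comp i j x y)" "cmp k (Comp i k x z)"
    and e: "i \<le> e" "e \<le> j" "e \<le> k" and yz: "eqv e (bnd s e y) (bnd s' e z)"
  shows "eqv e (bnd s e (Comp i j x y)) (bnd s' e (Comp i k x z))"
proof -
  have min: "min i e = i" "min j e = e" "min k e = e" "min i j \<le> e" "min i k \<le> e"
    "min e j = e" "min e k = e"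
    using e by auto
  have x: "cmp i x" "bnd s e x = x" "bnd s' e x = x"
    using assms(3) bnd_self[of i x] e by (auto simp: cmp_Comp_iff)
  have b: "bnd s e (Comp i j x y) = Comp i e x (bnd s e y)"
    "bnd s' e (Comp i k x z) = Comp i e x (bnd s' e z)"
    using bnd_Comp_ge[OF cmp_tree[OF assms(3)] min(4), of s]
      bnd_Comp_ge[OF cmp_tree[OF assms(4)] min(5), of s'] min x by simp_all
  have "cmp e (bnd s e (Comp i j x y))" "cmp e (bnd s' e (Comp i k x z))"
    using globular_cmp[OF assms(1,3), of e s] globular_cmp[OF assms(2,4), of e s'] min by simp_all
  then show ?thesis unfolding b by (intro cong_comp equiv_refl x yz)
qed

lemma faces_cong_left:
  assumes "globular j" "globular k" "cmp j (Comp j i y x)" "cmp k (Comp k i z x)"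
    and e: "i \<le> e" "e \<le> j" "e \<le> k" and yz: "eqv e (bnd s e y) (bnd s' e z)"
  shows "eqv e (bnd s e (Comp j i y x)) (bnd s' e (Comp k i z x))"
proof -
  have min: "min i e = i" "min j e = e" "min k e = e" "min j i \<le> e" "min k i \<le> e"
    "min e j = e" "min e k = e"
    using e by auto
  have x: "cmp i x" "bnd s e x = x" "bnd s' e x = x"
    using assms(3) bnd_self[of i x] e by (auto simp: cmp_Comp_iff)
  have b: "bnd s e (Comp j i y x) = Comp e i (bnd s e y) x"
    "bnd s' e (Comp k i z x) = Comp e i (bnd s' e z) x"
    using bnd_Comp_ge[OF cmp_tree[OF assms(3)] min(4), of s]
      bnd_Comp_ge[OF cmp_tree[OF assms(4)] min(5), of s'] min x by simp_all
  have "cmp e (bnd s e (Comp j i y x))" "cmp e (bnd s' e (Comp k i z x))"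
    using globular_cmp[OF assms(1,3), of e s] globular_cmp[OF assms(2,4), of e s'] min by simp_all
  then show ?thesis unfolding b by (intro cong_comp equiv_refl x yz)
qed

text \<open>By globularity an \<open>f\<close>-face can be computed through either
  \<open>e\<close>-face, so one equivalent pair of \<open>e\<close>-faces settles all lower
  faces.\<close>

lemma lower_faces_eqv:
  assumes "globular a" "globular b" "invariant e" "cmp a y" "cmp b z"
    and "f < e" "e < a" "e < b" "eqv e (bnd u e y) (bnd u' e z)"
  shows "eqv f (bnd s f y) (bnd s f z)"
proof -
  have min: "min f a = f" "min f b = f" "min f e = f" using assms by auto
  have "eqv f (bnd s f (bnd u e y)) (bnd s f y)" "eqv f (bnd s f (bnd u' e z)) (bnd s f z)"
    "eqv f (bnd s f (bnd u e y)) (bnd s f (bnd u' e z))"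
    using globular_eqv[OF assms(1,4,6), of s u] globular_eqv[OF assms(2,5,6), of s u']
      invariant_eqv[OF assms(3,9), of f s] min by simp_all
  then show ?thesis by (meson equiv_sym equiv_trans)
qed

text \<open>All matching conditions lie in dimension \<open>m - 1\<close>, where a face of a
  composite is a face of one input. Both sides thus say that \<open>x\<close> matches
  \<open>y\<close> and \<open>y\<close> matches \<open>z\<close>.\<close>

lemma cmp_assoc_iff:
  assumes m: "min a b = m" "min b c = m" "min a c = m"
  shows "cmp d (Comp (max a b) c (Comp a b x y) z) \<longleftrightarrow>
    cmp d (Comp a (max b c) x (Comp b c y z))"
proof (cases "1 \<le> m \<and> a \<le> n \<and> b \<le> n \<and> c \<le> n \<and> cmp a x \<and> cmp b y \<and> cmp c z")
  case False
  then show ?thesis using m unfolding cmp_Comp_iff by auto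
next
  case True
  then have b: "bnd s (m - 1) (Comp a b x y) = bnd s (m - 1) (pick s x y)"
    "bnd s (m - 1) (Comp b c y z) = bnd s (m - 1) (pick s y z)" for s
    using m cmp_tree by (auto intro!: bnd_Comp_less[OF is_tree.comp])
  have m': "min (max a b) c = m" "min a (max b c) = m" "max (max a b) c = max a (max b c)"
    using m by auto
  show ?thesis using True m unfolding cmp_Comp_iff m m' b by auto
qed

text \<open>The whisker \<open>x\<close> matches \<open>y\<close> because the target of the inner
  composite is that of \<open>y\<close>. It matches \<open>z\<close> as well, since \<open>y\<close>
  and \<open>z\<close> meet in dimension \<open>e > i - 1\<close> and so have equivalent lower
  targets.\<close>

lemma cmp_distrib_left:
  assumes glob: "\<And>e. e \<le> d \<Longrightarrow> globular e" and inv: "\<And>e. e < d \<Longrightarrow> invariant e"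
    and i: "i < min a b" and c: "cmp d (Comp i (max a b) x (Comp a b y z))"
  shows "cmp d (Comp a b (Comp i a x y) (Comp i b x z))"
proof -
  define e where "e = min a b - 1"
  have mins: "min i (max a b) = i" "max i (max a b) = max a b" "min i a = i" "min i b = i"
    "max i a = a" "max i b = b" "i - 1 < min a b"
    using i by auto
  have 1: "d = max a b" "1 \<le> i" "i \<le> n" "a \<le> n" "b \<le> n" "cmp i x" "cmp a y" "cmp b z"
    and yz: "eqv e (bnd Rgt e y) (bnd Lft e z)"
    and xyz: "eqv (i - 1) (bnd Rgt (i - 1) x) (bnd Lft (i - 1) (Comp a b y z))"
    and t: "tree (max a b) (Comp a b y z)"
    using c cmp_tree[of "max a b" "Comp a b y z"] unfolding cmp_Comp_iff e_def mins by auto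
  have e: "i - 1 < e" "e < a" "e < b" "a \<le> d" "b \<le> d" "i \<le> e" "e < d" "1 \<le> a" "1 \<le> b"
    using i 1 by (auto simp: e_def)
  note g = glob[OF e(4)] glob[OF e(5)]
  have xy: "eqv (i - 1) (bnd Rgt (i - 1) x) (bnd Lft (i - 1) y)"
    using xyz bnd_Comp_less[OF t mins(7), of Lft] by simp
  have "eqv (i - 1) (bnd Lft (i - 1) y) (bnd Lft (i - 1) z)"
    using lower_faces_eqv[OF g inv[OF e(7)] 1(7,8) e(1-3) yz] .
  with xy have "eqv (i - 1) (bnd Rgt (i - 1) x) (bnd Lft (i - 1) z)" by (rule equiv_trans)
  with xy have cs: "cmp a (Comp i a x y)" "cmp b (Comp i b x z)"
    unfolding cmp_Comp_iff mins using 1 e by auto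
  have "eqv e (bnd Rgt e (Comp i a x y)) (bnd Lft e (Comp i b x z))"
    using e yz by (intro faces_cong_right g cs) auto
  then show ?thesis unfolding cmp_Comp_iff[of d a b] using 1 e cs unfolding e_def by blast
qed

text \<open>Mirror image of \<open>cmp_distrib_left\<close>: the source of the inner composite is
  that of \<open>y\<close>, and matching with \<open>z\<close> is carried over to
  \<open>x\<close>.\<close>

lemma cmp_distrib_right:
  assumes glob: "\<And>e. e \<le> d \<Longrightarrow> globular e" and inv: "\<And>e. e < d \<Longrightarrow> invariant e"
    and i: "i < min a b" and c: "cmp d (Comp (max a b) i (Comp a b x y) z)"
  shows "cmp d (Comp a b (Comp a i x z) (Comp b i y z))"
proof -
  define e where "e = min a b - 1"
  have mins: "min (max a b) i = i" "max (max a b) i = max a b" "min a i = i" "min b i = i"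
    "max a i = a" "max b i = b" "i - 1 < min a b"
    using i by auto
  have 1: "d = max a b" "1 \<le> i" "i \<le> n" "a \<le> n" "b \<le> n" "cmp a x" "cmp b y" "cmp i z"
    and xy: "eqv e (bnd Rgt e x) (bnd Lft e y)"
    and xyz: "eqv (i - 1) (bnd Rgt (i - 1) (Comp a b x y)) (bnd Lft (i - 1) z)"
    and t: "tree (max a b) (Comp a b x y)"
    using c cmp_tree[of "max a b" "Comp a b x y"] unfolding cmp_Comp_iff e_def mins by auto
  have e: "i - 1 < e" "e < a" "e < b" "a \<le> d" "b \<le> d" "i \<le> e" "e < d" "1 \<le> a" "1 \<le> b"
    using i 1 by (auto simp: e_def)
  note g = glob[OF e(4)] glob[OF e(5)]
  have yz: "eqv (i - 1) (bnd Rgt (i - 1) y) (bnd Lft (i - 1) z)"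
    using xyz bnd_Comp_less[OF t mins(7), of Rgt] by simp
  have "eqv (i - 1) (bnd Rgt (i - 1) x) (bnd Rgt (i - 1) y)"
    using lower_faces_eqv[OF g inv[OF e(7)] 1(6,7) e(1-3) xy] .
  then have "eqv (i - 1) (bnd Rgt (i - 1) x) (bnd Lft (i - 1) z)"
    using yz by (rule equiv_trans)
  with yz have cs: "cmp a (Comp a i x z)" "cmp b (Comp b i y z)"
    unfolding cmp_Comp_iff mins using 1 e by auto
  have "eqv e (bnd Rgt e (Comp a i x z)) (bnd Lft e (Comp b i y z))"
    using e xy by (intro faces_cong_left g cs) auto
  then show ?thesis unfolding cmp_Comp_iff[of d a b] using 1 e cs unfolding e_def by blast
qed

text \<open>The rule \<open>basic\<close> asks for compatibility of the left side only. The
  hypotheses are what the induction on dimension provides at this stage.\<close>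

lemma basic_rel_cmp:
  assumes glob: "\<And>e. e \<le> d \<Longrightarrow> globular e" and inv: "\<And>e. e < d \<Longrightarrow> invariant e"
    and "basic_rel t u" "cmp d t"
  shows "cmp d u"
  using assms(3)
proof (cases rule: basic_rel_cases)
  case (unit_left i k x y)
  then show ?thesis using assms(4) by (auto simp: cmp_Comp_iff)
next
  case (unit_right i k x y)
  then show ?thesis using assms(4) by (auto simp: cmp_Comp_iff)
next
  case (ident_left i k x y)
  then have mins: "min i k = i" "min i (k - 1) = i" "max i k = k" "max i (k - 1) = k - 1" by auto
  have c: "d = k" "1 \<le> i" "i \<le> n" "k \<le> n" "cmp i x" "cmp k (Ident k y)"
    and e: "eqv (i - 1) (bnd Rgt (i - 1) x) (bnd Lft (i - 1) (Ident k y))"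
    using assms(4) unfolding ident_left cmp_Comp_iff mins by auto
  have "bnd Lft (i - 1) (Ident k y) = bnd Lft (i - 1) y"
    using bnd_step[OF cmp_tree[OF c(6)], of "i - 1" Lft] ident_left by simp
  then show ?thesis
    using c e ident_left unfolding ident_left cmp_Ident_iff cmp_Comp_iff mins by auto
next
  case (ident_right i k x y)
  then have mins: "min k i = i" "min (k - 1) i = i" "max k i = k" "max (k - 1) i = k - 1" by auto
  have c: "d = k" "1 \<le> i" "i \<le> n" "k \<le> n" "cmp i y" "cmp k (Ident k x)"
    and e: "eqv (i - 1) (bnd Rgt (i - 1) (Ident k x)) (bnd Lft (i - 1) y)"
    using assms(4) unfolding ident_right cmp_Comp_iff mins by auto
  have "bnd Rgt (i - 1) (Ident k x) = bnd Rgt (i - 1) x"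
    using bnd_step[OF cmp_tree[OF c(6)], of "i - 1" Rgt] ident_right by simp
  then show ?thesis
    using c e ident_right unfolding ident_right cmp_Ident_iff cmp_Comp_iff mins by auto
next
  case (assoc a b c m x y z)
  then show ?thesis using assms(4) cmp_assoc_iff[OF assoc(1-3)] by simp
next
  case (distrib_left i a b x y z)
  then show ?thesis using assms(4) cmp_distrib_left[OF glob inv] by blast
next
  case (distrib_right i a b x y z)
  then show ?thesis using assms(4) cmp_distrib_right[OF glob inv] by blast
qed

text \<open>Induction on the derivation handles single faces; iterated faces then follow from
  \<open>invariant (d - 1)\<close>.\<close>

lemma invariant_step:
  assumes glob: "\<And>e. e \<le> d \<Longrightarrow> globular e" and inv: "\<And>e. e < d \<Longrightarrow> invariant e"
  shows "invariant d"
proof -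
  have face: "cmp (k - 1) (fc s x)" if "cmp k x" "k \<le> d" "1 \<le> k" for k x s
    using globular_cmp[OF glob that(1), of "k - 1" s] bnd_pred[OF cmp_tree[OF that(1)], of s] that
    by (simp add: min_def split: if_splits)
  \<comment> \<open>All dimensions up to \<open>d\<close> are treated together because the
    congruence rules refer to inputs of smaller dimension.\<close>
  have main: "cmp k x \<and> cmp k y \<and> (\<forall>s. 1 \<le> k \<longrightarrow> eqv (k - 1) (fc s x) (fc s y))"
    if "eqv k x y" "k \<le> d" for k x y
    using that
  proof (induction rule: compatible_equiv_tree.inducts(2)[where ?P1.0 = "\<lambda>_ _. True"])
    case (equiv_refl k x)
    then show ?case using face by (auto intro: compatible_equiv_tree.equiv_refl)
  next
    case (equiv_sym k x y)
    then show ?case by (auto intro: compatible_equiv_tree.equiv_sym)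
  next
    case (equiv_trans k x y z)
    then show ?case by (auto intro: compatible_equiv_tree.equiv_trans)
  next
    case (cong_ident i x x' k)
    then show ?case by (auto simp: cmp_Ident_iff)
  next
    case (cong_comp i x x' j y y' k)
    then have c: "k = max i j" "1 \<le> i" "1 \<le> j" "i \<le> d" "j \<le> d" "1 \<le> k"
      by (auto simp: cmp_Comp_iff)
    then have fx: "eqv (i - 1) (fc s x) (fc s x')" and fy: "eqv (j - 1) (fc s y) (fc s y')" for s
      using cong_comp by auto
    have f: "cmp (k - 1) (fc s (Comp i j x y))" "cmp (k - 1) (fc s (Comp i j x' y'))" for s
      by (intro face cong_comp.hyps cong_comp.prems c)+
    have "eqv (k - 1) (fc s (Comp i j x y)) (fc s (Comp i j x' y'))" for s
    proof (cases i j rule: linorder_cases)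
      case less
      then show ?thesis
        using f[of s] fy[of s] cong_comp.hyps(1)
        by (auto intro: compatible_equiv_tree.cong_comp)
    next
      case equal
      then show ?thesis using fx[of s] fy[of s] c by (cases s) auto
    next
      case greater
      then show ?thesis
        using f[of s] fx[of s] cong_comp.hyps(2)
        by (auto intro: compatible_equiv_tree.cong_comp)
    qed
    then show ?case using cong_comp by auto
  next
    case (basic t u k)
    have cu: "cmp k u"
      using basic_rel_cmp[OF _ _ basic.hyps(1,2)] glob inv basic.prems by simp
    have "eqv (k - 1) (fc s t) (fc s u)" if k: "1 \<le> k" for s
    proof -
      have ft: "cmp (k - 1) (fc s t)" and fu: "cmp (k - 1) (fc s u)"
        using face[OF basic.hyps(2)] face[OF cu] basic.prems k by blast+
      consider "fc s t = fc s u" | "basic_rel (fc s t) (fc s u)"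
        | l x y where "t = Comp l l (Ident l x) y" "u = y" "s = Lft"
        | l x y where "t = Comp l l x (Ident l y)" "u = x" "s = Rgt"
        using basic_rel_face[OF basic.hyps(1), of C s] by blast
      then show ?thesis
      proof cases
        case 1
        then show ?thesis using fu by (simp add: compatible_equiv_tree.equiv_refl)
      next
        case 2
        then show ?thesis using ft by (rule compatible_equiv_tree.basic)
      next
        \<comment> \<open>In this unit law the matching condition of the composite is itself the
          claim.\<close>
        case 3
        then have c: "k = l" "cmp l (Ident l x)" "cmp l y"
          and e: "eqv (l - 1) (bnd Rgt (l - 1) (Ident l x)) (bnd Lft (l - 1) y)"
          using basic.hyps(2) by (auto simp: cmp_Comp_iff)
        show ?thesis
          using e 3 c k bnd_pred[OF cmp_tree[OF c(2)], of Rgt] bnd_pred[OF cmp_tree[OF c(3)], of Lft]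
          by simp
      next
        case 4
        then have c: "k = l" "cmp l x" "cmp l (Ident l y)"
          and e: "eqv (l - 1) (bnd Rgt (l - 1) x) (bnd Lft (l - 1) (Ident l y))"
          using basic.hyps(2) by (auto simp: cmp_Comp_iff)
        show ?thesis
          using e 4 c k bnd_pred[OF cmp_tree[OF c(2)], of Rgt] bnd_pred[OF cmp_tree[OF c(3)], of Lft]
          by (simp add: compatible_equiv_tree.equiv_sym)
      qed
    qed
    with cu basic.hyps show ?case by blast
  qed simp_all
  have "eqv (min e d) (bnd s e x) (bnd s e y)" if "eqv d x y" for x y s e
  proof (cases "e < d")
    case True
    then have d: "d - 1 < d" "min e (d - 1) = e" "min e d = e" "1 \<le> d" by auto
    have xy: "tree d x" "tree d y" "eqv (d - 1) (fc s x) (fc s y)"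
      using main[OF that] d cmp_tree by auto
    show ?thesis
      using invariant_eqv[OF inv[OF d(1)] xy(3), of e s] d
        bnd_step[OF xy(1) True, of s] bnd_step[OF xy(2) True, of s] by simp
  next
    case False
    then have "bnd s e x = x" "bnd s e y = y" "min e d = d"
      using main[OF that] bnd_self[of d] by auto
    with that show ?thesis by simp
  qed
  with main show ?thesis unfolding invariant_def by blast
qed

text \<open>In each dimension globularity comes first, as the invariance step uses it in the same
  dimension.\<close>

lemma globular_invariant: "globular d \<and> invariant d"
proof (induction d rule: less_induct)
  case (less d)
  have "globular d" by (rule globular_step) (use less in blast)+
  then have "globular e" if "e \<le> d" for e
    using less[of e] that by (cases "e = d") auto
  moreover have "invariant e" if "e < d" for e
    using less[OF that] by blast
  ultimately show ?case using invariant_step[of d] \<open>globular d\<close> by blast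
qed

section \<open>Congruence with compatibility required on one side only\<close>

lemma eqv_cmp: "eqv d x y \<Longrightarrow> cmp d x" "eqv d x y \<Longrightarrow> cmp d y"
  using globular_invariant[of d] invariant_cmp[of d x y] by blast+

lemma eqv_faces: "eqv d x y \<Longrightarrow> e \<le> d \<Longrightarrow> eqv e (bnd s e x) (bnd s e y)"
  using globular_invariant[of d] invariant_eqv[of d x y e s] by (simp add: min_absorb1)

text \<open>Equivalent inputs have equivalent faces, so the matching condition transfers. This
  discharges the second compatibility premise of \<open>cong_comp\<close>.\<close>

lemma cmp_Comp_cong:
  assumes "eqv i x x'" "eqv j y y'" "cmp d (Comp i j x y)"
  shows "cmp d (Comp i j x' y')"
proof -
  have "1 \<le> i" "1 \<le> j" "eqv (min i j - 1) (bnd Rgt (min i j - 1) x) (bnd Lft (min i j - 1) y)"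
    using assms(3) by (auto simp: cmp_Comp_iff)
  moreover from this have "eqv (min i j - 1) (bnd Rgt (min i j - 1) x) (bnd Rgt (min i j - 1) x')"
    "eqv (min i j - 1) (bnd Lft (min i j - 1) y) (bnd Lft (min i j - 1) y')"
    by (auto intro!: eqv_faces assms(1,2))
  ultimately have "eqv (min i j - 1) (bnd Rgt (min i j - 1) x') (bnd Lft (min i j - 1) y')"
    by (meson equiv_sym equiv_trans)
  then show ?thesis
    using assms(3) eqv_cmp(2)[OF assms(1)] eqv_cmp(2)[OF assms(2)]
    unfolding cmp_Comp_iff by blast
qed

lemma eqv_Comp_cong:
  "eqv i x x' \<Longrightarrow> eqv j y y' \<Longrightarrow> cmp d (Comp i j x y) \<Longrightarrow>
    eqv d (Comp i j x y) (Comp i j x' y')"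
  by (rule cong_comp) (simp_all add: cmp_Comp_cong)

end

section \<open>Reduced trees\<close>

primrec label :: "'a tree \<Rightarrow> (nat \<times> nat) option" where
  "label (Leaf k c) = None"
| "label (Ident i x) = None"
| "label (Comp i j x y) = Some (i, j)"

text \<open>
  The value 0 is junk: on trees with dimensions it occurs only if the root is not \<open>\<circ>\<close>-labelled.
\<close>

primrec top_m :: "'a tree \<Rightarrow> nat" where
  "top_m (Leaf k c) = 0"
| "top_m (Ident i x) = 0"
| "top_m (Comp i j x y) = min i j"

primrec is_ident :: "'a tree \<Rightarrow> bool" where
  "is_ident (Leaf k c) = False"
| "is_ident (Ident i x) = True"
| "is_ident (Comp i j x y) = False"

text \<open>Normal form as a local condition on each vertex and the roots of its inputs. A strict
  bound on an input keeps it out of the component, so that a component can continue only to the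
  right of \<open>Comp i k\<close> and only to the left of \<open>Comp k i\<close> or
  \<open>Comp k k\<close>. Forbidding the label \<open>(j, i)\<close> keeps every
  \<open>Comp i k\<close> of a whisker chain before every \<open>Comp k i\<close>.\<close>

primrec reduced :: "'a tree \<Rightarrow> bool" where
  "reduced (Leaf k c) = True"
| "reduced (Ident i x) = reduced x"
| "reduced (Comp i j x y) \<longleftrightarrow>
    reduced x \<and> reduced y \<and> \<not> is_ident x \<and> \<not> is_ident y \<and>
    (if i < j then top_m x < i \<and> top_m y \<le> i
     else top_m x \<le> j \<and> top_m y < j \<and> (j < i \<longrightarrow> label x \<noteq> Some (j, i)))"

text \<open>These are the trees that may stand as inputs of a composition in a reduced tree.\<close>

definition reduced_comp :: "'a tree \<Rightarrow> bool" where
  "reduced_comp x \<longleftrightarrow> reduced x \<and> \<not> is_ident x"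

lemma top_m_label: "label x = Some (i, j) \<Longrightarrow> top_m x = min i j"
  by (cases x) auto

lemma label_SomeE:
  assumes "label x = Some (i, j)"
  obtains y z where "x = Comp i j y z"
  using assms by (cases x) auto

lemma is_tree_top_m_le: "is_tree n X d x \<Longrightarrow> top_m x \<le> d"
  by (cases x) (auto simp: is_tree_iff)

lemma is_tree_label_less:
  "is_tree n X d x \<Longrightarrow> top_m x = i \<Longrightarrow> 1 \<le> i \<Longrightarrow> i < d \<Longrightarrow>
    label x = Some (i, d) \<or> label x = Some (d, i)"
  by (cases x) (auto simp: is_tree_iff min_def max_def split: if_splits)

lemma reduced_comp_right:
  "i < k \<Longrightarrow> reduced_comp (Comp i k x y) \<longleftrightarrow>
    reduced_comp x \<and> reduced_comp y \<and> top_m x < i \<and> top_m y \<le> i"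
  by (auto simp: reduced_comp_def)

lemma reduced_comp_left:
  "i < k \<Longrightarrow> reduced_comp (Comp k i x y) \<longleftrightarrow>
    reduced_comp x \<and> reduced_comp y \<and> top_m x \<le> i \<and> top_m y < i \<and> label x \<noteq> Some (i, k)"
  by (auto simp: reduced_comp_def)

lemma reduced_comp_diag:
  "reduced_comp (Comp k k x y) \<longleftrightarrow>
    reduced_comp x \<and> reduced_comp y \<and> top_m x \<le> k \<and> top_m y < k"
  by (auto simp: reduced_comp_def)

lemma reduced_comp_inputs:
  "reduced_comp (Comp i j x y) \<Longrightarrow>
    reduced_comp x \<and> reduced_comp y \<and> top_m x \<le> min i j \<and> top_m y \<le> min i j"
  by (auto simp: reduced_comp_def split: if_splits)


section \<open>Normalization\<close>

context full_computad begin

lemma cmp_top_m_le: "cmp d x \<Longrightarrow> top_m x \<le> d"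
  using is_tree_top_m_le cmp_tree by blast

text \<open>If \<open>y\<close> is itself a \<open>Comp k k\<close>, reassociate to the left:
  \<open>y1\<close> is absorbed into \<open>x\<close> by induction, and \<open>y2\<close>, whose
  value is already below \<open>k\<close>, becomes the right input.\<close>

lemma normalize_diag:
  "cmp k (Comp k k x y) \<Longrightarrow> reduced_comp x \<Longrightarrow> reduced_comp y \<Longrightarrow>
    \<exists>z. reduced_comp z \<and> eqv k (Comp k k x y) z"
proof (induction y rule: tree.induct)
  case (Leaf l c)
  then have "reduced_comp (Comp k k x (Leaf l c))"
    using cmp_top_m_le[of k x] by (auto simp: reduced_comp_diag cmp_Comp_iff)
  then show ?case using Leaf equiv_refl by blast
next
  case (Ident i y)
  then show ?case by (simp add: reduced_comp_def)
next
  case (Comp i j y1 y2)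
  have c: "cmp k x" "cmp k (Comp i j y1 y2)" "max i j = k" "1 \<le> k"
    using Comp.prems(1) by (auto simp: cmp_Comp_iff)
  show ?case
  proof (cases "min i j < k")
    case True
    then have "reduced_comp (Comp k k x (Comp i j y1 y2))"
      using Comp.prems cmp_top_m_le[OF c(1)] by (simp add: reduced_comp_diag)
    then show ?thesis using Comp.prems(1) equiv_refl by blast
  next
    case False
    then have ij: "i = k" "j = k" using c by auto
    \<comment> \<open>The generator \<open>assoc\<close> points the other way, so compatibility of
      its left side must be supplied first.\<close>
    have L: "cmp k (Comp k k (Comp k k x y1) y2)"
      using Comp.prems(1) cmp_assoc_iff[of k k k k k x y1 y2] unfolding ij by simp
    then have "cmp k (Comp k k x y1)" "cmp k y2" by (auto simp: cmp_Comp_iff)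
    moreover have y: "reduced_comp y1" "reduced_comp y2" "top_m y2 < k"
      using Comp.prems(3) unfolding ij reduced_comp_diag by auto
    ultimately obtain z where z: "reduced_comp z" "eqv k (Comp k k x y1) z"
      using Comp.IH(1) Comp.prems(2) by blast
    have "eqv k (Comp k k (Comp k k x y1) y2) (Comp k k z y2)"
      using z(2) \<open>cmp k y2\<close> L by (intro eqv_Comp_cong equiv_refl)
    moreover have "eqv k (Comp k k (Comp k k x y1) y2) (Comp k k x (Comp k k y1 y2))"
      using L by (intro basic basic_rel.assoc)
    ultimately have "eqv k (Comp k k x (Comp k k y1 y2)) (Comp k k z y2)"
      by (meson equiv_sym equiv_trans)
    moreover have "reduced_comp (Comp k k z y2)"
      using z y cmp_top_m_le[OF eqv_cmp(2)[OF z(2)]] by (simp add: reduced_comp_diag)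
    ultimately show ?thesis unfolding ij by blast
  qed
qed

text \<open>The only obstruction is a root \<open>Comp i i\<close> in \<open>x\<close>.
  Reassociation moves its right input onto the chain ending in \<open>y\<close>, which therefore
  varies in the induction.\<close>

lemma normalize_left_whisker_low:
  assumes "i < k"
  shows "cmp k (Comp i k x y) \<Longrightarrow> reduced_comp x \<Longrightarrow> reduced_comp y \<Longrightarrow> top_m y \<le> i \<Longrightarrow>
    \<exists>z. reduced_comp z \<and> label z = Some (i, k) \<and> eqv k (Comp i k x y) z"
proof (induction x arbitrary: y rule: tree.induct)
  case (Leaf l c)
  then have "reduced_comp (Comp i k (Leaf l c) y)"
    using assms by (auto simp: reduced_comp_right cmp_Comp_iff)
  then show ?case using Leaf equiv_refl by fastforce
next
  case (Ident i x)
  then show ?case by (simp add: reduced_comp_def)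
next
  case (Comp a b x1 x2)
  have c: "cmp k y" "cmp i (Comp a b x1 x2)" "max a b = i" "1 \<le> i"
    using Comp.prems(1) by (auto simp: cmp_Comp_iff)
  show ?case
  proof (cases "min a b < i")
    case True
    then have "reduced_comp (Comp i k (Comp a b x1 x2) y)"
      using Comp.prems assms by (simp add: reduced_comp_right)
    then show ?thesis using Comp.prems(1) equiv_refl by fastforce
  next
    case False
    then have ab: "a = i" "b = i" using c by auto
    have R: "cmp k (Comp i k x1 (Comp i k x2 y))"
      using Comp.prems(1) cmp_assoc_iff[of i i i k k x1 x2 y] assms unfolding ab
      by (simp add: max_def)
    have x: "reduced_comp x1" "reduced_comp x2" "top_m x2 < i"
      using Comp.prems(2) unfolding ab reduced_comp_diag by auto
    then have "reduced_comp (Comp i k x2 y)" "top_m (Comp i k x2 y) \<le> i"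
      using Comp.prems assms by (auto simp: reduced_comp_right)
    then obtain z where z: "reduced_comp z" "label z = Some (i, k)"
      "eqv k (Comp i k x1 (Comp i k x2 y)) z"
      using Comp.IH(1)[OF R x(1)] by blast
    moreover have "eqv k (Comp i k (Comp i i x1 x2) y) (Comp i k x1 (Comp i k x2 y))"
      using Comp.prems(1) assms unfolding ab by (intro basic basic_rel.assoc_left)
    ultimately show ?thesis unfolding ab by (meson equiv_trans)
  qed
qed

text \<open>Tracking the label drives the induction: after distributing over
  \<open>Comp a b\<close>, each input keeps its root label or gets one with value
  \<open>i < min a b\<close>, so no condition at that vertex breaks. The dimension \<open>k\<close>
  varies because the two inputs have dimensions \<open>a\<close> and \<open>b\<close>.\<close>

lemma normalize_left_whisker:
  "i < k \<Longrightarrow> cmp k (Comp i k x y) \<Longrightarrow> reduced_comp x \<Longrightarrow> reduced_comp y \<Longrightarrow>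
    \<exists>z. reduced_comp z \<and> label z = (if top_m y \<le> i then Some (i, k) else label y) \<and>
      eqv k (Comp i k x y) z"
proof (induction y arbitrary: k rule: tree.induct)
  case (Leaf l c)
  then show ?case using normalize_left_whisker_low[of i k x "Leaf l c"] by simp
next
  case (Ident i x)
  then show ?case by (simp add: reduced_comp_def)
next
  case (Comp a b y1 y2)
  show ?case
  proof (cases "min a b \<le> i")
    case True
    then show ?thesis
      using normalize_left_whisker_low[of i k x "Comp a b y1 y2"] Comp.prems by simp
  next
    case False
    then have i: "i < min a b" "i < a" "i < b" by auto
    have k: "k = max a b" using Comp.prems(2) by (auto simp: cmp_Comp_iff)
    have eqv: "eqv k (Comp i k x (Comp a b y1 y2)) (Comp a b (Comp i a x y1) (Comp i b x y2))"
      using Comp.prems(2) basic_rel_distrib_left[OF i(1)] unfolding k by (intro basic)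
    note R = eqv_cmp(2)[OF eqv]
    then have cs: "cmp a (Comp i a x y1)" "cmp b (Comp i b x y2)"
      by (auto simp: cmp_Comp_iff)
    have y: "reduced_comp y1" "reduced_comp y2" "top_m y1 \<le> min a b" "top_m y2 \<le> min a b"
      using reduced_comp_inputs[OF Comp.prems(4)] by auto
    obtain z1 where z1: "reduced_comp z1" "eqv a (Comp i a x y1) z1"
      "label z1 = (if top_m y1 \<le> i then Some (i, a) else label y1)"
      using Comp.IH(1)[OF i(2) cs(1) Comp.prems(3) y(1)] by blast
    obtain z2 where z2: "reduced_comp z2" "eqv b (Comp i b x y2) z2"
      "label z2 = (if top_m y2 \<le> i then Some (i, b) else label y2)"
      using Comp.IH(2)[OF i(3) cs(2) Comp.prems(3) y(2)] by blast
    \<comment> \<open>Values are raised at most to \<open>i\<close>, which is below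
      \<open>min a b\<close>, so the bounds required at the vertex persist.\<close>
    have m1: "top_m z1 = max i (top_m y1)"
      using z1(3) i by (cases z1; cases y1) (auto split: if_splits)
    have m2: "top_m z2 = max i (top_m y2)"
      using z2(3) i by (cases z2; cases y2) (auto split: if_splits)
    have "reduced_comp (Comp a b z1 z2)"
    proof (cases a b rule: linorder_cases)
      case less
      then show ?thesis
        using Comp.prems(4) z1 z2 m1 m2 i by (simp add: reduced_comp_right)
    next
      case equal
      then show ?thesis
        using Comp.prems(4) z1 z2 m1 m2 i by (simp add: reduced_comp_diag)
    next
      case greater
      then show ?thesis
        using Comp.prems(4) z1 z2 m1 m2 i by (simp add: reduced_comp_left)
    qed
    moreover have "eqv k (Comp i k x (Comp a b y1 y2)) (Comp a b z1 z2)"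
      using eqv eqv_Comp_cong[OF z1(2) z2(2) R] by (rule equiv_trans)
    ultimately show ?thesis using False by fastforce
  qed
qed

text \<open>The only obstruction is a root \<open>Comp i k\<close> in \<open>x\<close>;
  \<open>assoc_mid\<close> pushes the new \<open>Comp k i\<close> past all of these. Since the
  resulting root may be of either kind, only its value is recorded.\<close>

lemma normalize_right_whisker_low_high:
  assumes "i < k"
  shows "cmp k (Comp k i x y) \<Longrightarrow> reduced_comp x \<Longrightarrow> reduced_comp y \<Longrightarrow>
    top_m x \<le> i \<Longrightarrow> top_m y < i \<Longrightarrow>
    \<exists>z. reduced_comp z \<and> top_m z = i \<and> eqv k (Comp k i x y) z"
proof (induction x rule: tree.induct)
  case (Leaf l c)
  then have "reduced_comp (Comp k i (Leaf l c) y)"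
    using assms by (auto simp: reduced_comp_left)
  then show ?case using Leaf equiv_refl assms by fastforce
next
  case (Ident i x)
  then show ?case by (simp add: reduced_comp_def)
next
  case (Comp a b x1 x2)
  show ?case
  proof (cases "a = i \<and> b = k")
    case False
    then have "reduced_comp (Comp k i (Comp a b x1 x2) y)"
      using Comp.prems assms by (simp add: reduced_comp_left)
    then show ?thesis using Comp.prems(1) equiv_refl assms by fastforce
  next
    case True
    then have ab: "a = i" "b = k" by auto
    have eqv: "eqv k (Comp k i (Comp i k x1 x2) y) (Comp i k x1 (Comp k i x2 y))"
      using Comp.prems(1) assms unfolding ab by (intro basic basic_rel.assoc_mid)
    note R = eqv_cmp(2)[OF eqv]
    have cs: "cmp k (Comp k i x2 y)" "cmp i x1" using R by (auto simp: cmp_Comp_iff)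
    have x: "reduced_comp x1" "reduced_comp x2" "top_m x1 < i" "top_m x2 \<le> i"
      using Comp.prems(2) assms unfolding ab by (auto simp: reduced_comp_right)
    obtain z where z: "reduced_comp z" "top_m z = i" "eqv k (Comp k i x2 y) z"
      using Comp.IH(2)[OF cs(1) x(2) Comp.prems(3) x(4) Comp.prems(5)] by blast
    have "eqv k (Comp i k x1 (Comp k i x2 y)) (Comp i k x1 z)"
      using z R cs by (intro eqv_Comp_cong equiv_refl)
    with eqv have "eqv k (Comp k i (Comp i k x1 x2) y) (Comp i k x1 z)" by (rule equiv_trans)
    moreover have "reduced_comp (Comp i k x1 z)"
      using assms x z by (simp add: reduced_comp_right)
    ultimately show ?thesis using assms unfolding ab by fastforce
  qed
qed

text \<open>If \<open>y\<close> is a \<open>Comp i i\<close>, compose with \<open>y1\<close> by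
  induction and then with \<open>y2\<close>, whose value is below \<open>i\<close>, by the preceding
  lemma.\<close>

lemma normalize_right_whisker_low:
  assumes "i < k"
  shows "cmp k (Comp k i x y) \<Longrightarrow> reduced_comp x \<Longrightarrow> reduced_comp y \<Longrightarrow> top_m x \<le> i \<Longrightarrow>
    \<exists>z. reduced_comp z \<and> top_m z = i \<and> eqv k (Comp k i x y) z"
proof (induction y rule: tree.induct)
  case (Leaf l c)
  then have "1 \<le> i" by (auto simp: cmp_Comp_iff)
  then show ?case using normalize_right_whisker_low_high[OF assms Leaf] by simp
next
  case (Ident i x)
  then show ?case by (simp add: reduced_comp_def)
next
  case (Comp a b y1 y2)
  have c: "cmp k x" "cmp i (Comp a b y1 y2)" "max a b = i" "1 \<le> i"
    using Comp.prems(1) by (auto simp: cmp_Comp_iff)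
  show ?case
  proof (cases "min a b < i")
    case True
    then show ?thesis using normalize_right_whisker_low_high[OF assms Comp.prems] by simp
  next
    case False
    then have ab: "a = i" "b = i" using c by auto
    have L: "cmp k (Comp k i (Comp k i x y1) y2)"
      using Comp.prems(1) cmp_assoc_iff[of k i i i k x y1 y2] assms unfolding ab
      by (simp add: max_def)
    then have cs: "cmp k (Comp k i x y1)" "cmp i y2" by (auto simp: cmp_Comp_iff)
    have y: "reduced_comp y1" "reduced_comp y2" "top_m y2 < i"
      using Comp.prems(3) unfolding ab reduced_comp_diag by auto
    obtain z where z: "reduced_comp z" "top_m z = i" "eqv k (Comp k i x y1) z"
      using Comp.IH(1)[OF cs(1) Comp.prems(2) y(1) Comp.prems(4)] by blast
    have "eqv k (Comp k i (Comp k i x y1) y2) (Comp k i x (Comp i i y1 y2))"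
      using L assms by (intro basic basic_rel.assoc_right)
    moreover have zy: "eqv k (Comp k i (Comp k i x y1) y2) (Comp k i z y2)"
      using z L cs by (intro eqv_Comp_cong equiv_refl)
    ultimately have "eqv k (Comp k i x (Comp i i y1 y2)) (Comp k i z y2)"
      by (meson equiv_sym equiv_trans)
    moreover obtain w where "reduced_comp w" "top_m w = i" "eqv k (Comp k i z y2) w"
      using normalize_right_whisker_low_high[OF assms eqv_cmp(2)[OF zy] z(1) y(2) _ y(3)] z(2)
      by blast
    ultimately show ?thesis unfolding ab by (blast intro: equiv_trans)
  qed
qed

text \<open>As for left whiskers, but when the value of \<open>x\<close> is at most \<open>i\<close>
  the label of the result is not determined, only its value.\<close>

lemma normalize_right_whisker:
  "i < k \<Longrightarrow> cmp k (Comp k i x y) \<Longrightarrow> reduced_comp x \<Longrightarrow> reduced_comp y \<Longrightarrow>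
    \<exists>z. reduced_comp z \<and> (if top_m x \<le> i then top_m z = i else label z = label x) \<and>
      eqv k (Comp k i x y) z"
proof (induction x arbitrary: k rule: tree.induct)
  case (Leaf l c)
  then show ?case using normalize_right_whisker_low[of i k "Leaf l c" y] by simp
next
  case (Ident i x)
  then show ?case by (simp add: reduced_comp_def)
next
  case (Comp a b x1 x2)
  show ?case
  proof (cases "min a b \<le> i")
    case True
    then show ?thesis
      using normalize_right_whisker_low[of i k "Comp a b x1 x2" y] Comp.prems by simp
  next
    case False
    then have i: "i < min a b" "i < a" "i < b" by auto
    have k: "k = max a b" using Comp.prems(2) by (auto simp: cmp_Comp_iff)
    have eqv: "eqv k (Comp k i (Comp a b x1 x2) y) (Comp a b (Comp a i x1 y) (Comp b i x2 y))"
      using Comp.prems(2) basic_rel_distrib_right[OF i(1)] unfolding k by (intro basic)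
    note R = eqv_cmp(2)[OF eqv]
    then have cs: "cmp a (Comp a i x1 y)" "cmp b (Comp b i x2 y)"
      by (auto simp: cmp_Comp_iff)
    have x: "reduced_comp x1" "reduced_comp x2" "top_m x1 \<le> min a b" "top_m x2 \<le> min a b"
      using reduced_comp_inputs[OF Comp.prems(3)] by auto
    obtain z1 where z1: "reduced_comp z1" "eqv a (Comp a i x1 y) z1"
      "if top_m x1 \<le> i then top_m z1 = i else label z1 = label x1"
      using Comp.IH(1)[OF i(2) cs(1) x(1) Comp.prems(4)] by blast
    obtain z2 where z2: "reduced_comp z2" "eqv b (Comp b i x2 y) z2"
      "if top_m x2 \<le> i then top_m z2 = i else label z2 = label x2"
      using Comp.IH(2)[OF i(3) cs(2) x(2) Comp.prems(4)] by blast
    have m1: "top_m z1 = max i (top_m x1)"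
      using z1(3) i by (cases z1; cases x1) (auto split: if_splits)
    have m2: "top_m z2 = max i (top_m x2)"
      using z2(3) i by (cases z2; cases x2) (auto split: if_splits)
    have "reduced_comp (Comp a b z1 z2)"
    proof (cases a b rule: linorder_cases)
      case less
      then show ?thesis
        using Comp.prems(3) z1 z2 m1 m2 i by (simp add: reduced_comp_right)
    next
      case equal
      then show ?thesis
        using Comp.prems(3) z1 z2 m1 m2 i by (simp add: reduced_comp_diag)
    next
      case greater
      \<comment> \<open>Either the value of \<open>z1\<close> is \<open>i < b\<close>, which
        excludes the label, or the label is that of \<open>x1\<close>, where reducedness excludes
        it.\<close>
      then have "label z1 \<noteq> Some (b, a)"
        using Comp.prems(3) z1(3) i top_m_label[of z1 b a]
        by (auto simp: reduced_comp_left split: if_splits)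
      with greater show ?thesis
        using Comp.prems(3) z1 z2 m1 m2 i by (simp add: reduced_comp_left)
    qed
    moreover have "eqv k (Comp k i (Comp a b x1 x2) y) (Comp a b z1 z2)"
      using eqv eqv_Comp_cong[OF z1(2) z2(2) R] by (rule equiv_trans)
    ultimately show ?thesis using False by fastforce
  qed
qed

section \<open>Pulling out identities and existence of reduced trees\<close>

lemma normalize_reduced_comp:
  assumes "cmp d (Comp i j x y)" "reduced_comp x" "reduced_comp y"
  shows "\<exists>z. reduced z \<and> eqv d (Comp i j x y) z"
proof -
  have "d = max i j" using assms(1) by (simp add: cmp_Comp_iff)
  then consider "i < j" "d = j" | "i = j" "d = j" | "j < i" "d = i" by linarith
  then have "\<exists>z. reduced_comp z \<and> eqv d (Comp i j x y) z"
    using assms normalize_left_whisker[of i j x y] normalize_right_whisker[of j i x y]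
      normalize_diag[of j x y] by cases blast+
  then show ?thesis by (auto simp: reduced_comp_def)
qed

text \<open>An identity at the root of an input is either cancelled by a unit law or moved outside
  the composition. Moving it changes an index and the dimension but shrinks the total size of the
  inputs, which is the induction measure.\<close>

lemma normalize_reduced:
  "cmp d (Comp i j x y) \<Longrightarrow> reduced x \<Longrightarrow> reduced y \<Longrightarrow>
    \<exists>z. reduced z \<and> eqv d (Comp i j x y) z"
proof (induction "size x + size y" arbitrary: d i j x y rule: less_induct)
  case less
  consider "reduced_comp x" "reduced_comp y"
    | l x' where "x = Ident l x'" | l y' where "y = Ident l y'"
    using less.prems by (cases x; cases y) (auto simp: reduced_comp_def)
  then show ?case
  proof cases
    case 1
    then show ?thesis using normalize_reduced_comp less.prems by blast
  next
    case (2 l x')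
    then have l: "l = i" using less.prems(1) by (auto simp: cmp_Comp_iff cmp_Ident_iff)
    show ?thesis
    proof (cases "i \<le> j")
      case True
      then have "eqv d (Comp i j x y) y"
        using less.prems(1) unfolding 2 l by (intro basic basic_rel.unit_left)
      then show ?thesis using less.prems by blast
    next
      case False
      then have eqv: "eqv d (Comp i j x y) (Ident i (Comp (i - 1) j x' y))"
        using less.prems(1) unfolding 2 l by (intro basic basic_rel.ident_right) auto
      note R = eqv_cmp(2)[OF eqv]
      then have c: "cmp (i - 1) (Comp (i - 1) j x' y)" by (simp add: cmp_Ident_iff)
      have "size x' + size y < size x + size y" "reduced x'" using 2 less.prems by auto
      then obtain z where z: "reduced z" "eqv (i - 1) (Comp (i - 1) j x' y) z"
        using less.hyps[OF _ c _ less.prems(3)] by blast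
      then have "cmp d (Ident i z)"
        using eqv_cmp(2)[OF z(2)] R unfolding cmp_Ident_iff by auto
      with z(2) R have "eqv d (Ident i (Comp (i - 1) j x' y)) (Ident i z)" by (intro cong_ident)
      with eqv z show ?thesis by (metis equiv_trans reduced.simps(2))
    qed
  next
    case (3 l y')
    then have l: "l = j" using less.prems(1) by (auto simp: cmp_Comp_iff cmp_Ident_iff)
    show ?thesis
    proof (cases "j \<le> i")
      case True
      then have "eqv d (Comp i j x y) x"
        using less.prems(1) unfolding 3 l by (intro basic basic_rel.unit_right)
      then show ?thesis using less.prems by blast
    next
      case False
      then have eqv: "eqv d (Comp i j x y) (Ident j (Comp i (j - 1) x y'))"
        using less.prems(1) unfolding 3 l by (intro basic basic_rel.ident_left) auto
      note R = eqv_cmp(2)[OF eqv]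
      then have c: "cmp (j - 1) (Comp i (j - 1) x y')" by (simp add: cmp_Ident_iff)
      have "size x + size y' < size x + size y" "reduced y'" using 3 less.prems by auto
      then obtain z where z: "reduced z" "eqv (j - 1) (Comp i (j - 1) x y') z"
        using less.hyps[OF _ c less.prems(2)] by blast
      then have "cmp d (Ident j z)"
        using eqv_cmp(2)[OF z(2)] R unfolding cmp_Ident_iff by auto
      with z(2) R have "eqv d (Ident j (Comp i (j - 1) x y')) (Ident j z)" by (intro cong_ident)
      with eqv z show ?thesis by (metis equiv_trans reduced.simps(2))
    qed
  qed
qed

lemma ex_reduced: "cmp d x \<Longrightarrow> \<exists>z. reduced z \<and> eqv d x z"
proof (induction x arbitrary: d rule: tree.induct)
  case (Leaf k c)
  then show ?case by (meson equiv_refl reduced.simps(1))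
next
  case (Ident i x)
  then have c: "cmp (i - 1) x" by (simp add: cmp_Ident_iff)
  then obtain z where z: "reduced z" "eqv (i - 1) x z" using Ident.IH by blast
  then have "cmp d (Ident i z)"
    using eqv_cmp(2)[OF z(2)] Ident.prems unfolding cmp_Ident_iff by auto
  with z Ident.prems have "eqv d (Ident i x) (Ident i z)" by (intro cong_ident)
  with z show ?case by (metis reduced.simps(2))
next
  case (Comp i j x y)
  then have "cmp i x" "cmp j y" by (auto simp: cmp_Comp_iff)
  then obtain x' y' where xy: "reduced x'" "eqv i x x'" "reduced y'" "eqv j y y'"
    using Comp.IH by meson
  then have eqv: "eqv d (Comp i j x y) (Comp i j x' y')"
    using Comp.prems by (intro eqv_Comp_cong)
  then obtain z where "reduced z" "eqv d (Comp i j x' y') z"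
    using normalize_reduced[OF eqv_cmp(2)[OF eqv] xy(1,3)] by blast
  with eqv show ?case by (meson equiv_trans)
qed

end

section \<open>Components of reduced trees\<close>

lemma subtree_at_Comp [simp]: "subtree_at (Comp i j x y) (s # p) = subtree_at (pick s x y) p"
  by (cases s) auto

lemma subtree_at_append:
  "subtree_at x (p @ q) =
    (case subtree_at x p of None \<Rightarrow> None | Some t \<Rightarrow> subtree_at t q)"
  by (induction x p rule: subtree_at.induct) auto

lemma comp_labelled_iff:
  "comp_labelled x v i j \<longleftrightarrow> (\<exists>t. subtree_at x v = Some t \<and> label t = Some (i, j))"
  unfolding comp_labelled_def by (auto elim: label_SomeE)

lemma comp_vertices_iff:
  "v \<in> comp_vertices x \<longleftrightarrow> (\<exists>t. subtree_at x v = Some t \<and> label t \<noteq> None)"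
  unfolding comp_vertices_def comp_labelled_iff by auto

lemma m_val_eq: "subtree_at x v = Some t \<Longrightarrow> m_val x v = top_m t"
  unfolding m_val_def by (cases t) auto

lemma reduced_subtree:
  "subtree_at x p = Some t \<Longrightarrow> reduced x \<Longrightarrow> is_tree n X d x \<Longrightarrow>
    reduced t \<and> (\<exists>d. is_tree n X d t)"
  by (induction x p arbitrary: d rule: subtree_at.induct) (auto simp: is_tree_iff)

text \<open>Every vertex along the path, endpoints included, is a composition of value
  \<open>m\<close>. The paths with this property form the component hanging from the root of
  \<open>t\<close>.\<close>

primrec same_m :: "nat \<Rightarrow> vertex \<Rightarrow> 'a tree \<Rightarrow> bool" where
  "same_m m [] t \<longleftrightarrow> label t \<noteq> None \<and> top_m t = m"
| "same_m m (s # p) t \<longleftrightarrow>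
    (case t of Comp i j x y \<Rightarrow> min i j = m \<and> same_m m p (pick s x y) | _ \<Rightarrow> False)"

lemma same_m_top: "same_m m p t \<Longrightarrow> label t \<noteq> None \<and> top_m t = m"
  by (cases p; cases t) auto

lemma same_m_subtree:
  "same_m m p t \<Longrightarrow> \<exists>u. subtree_at t p = Some u \<and> label u \<noteq> None \<and> top_m u = m"
  by (induction p arbitrary: t) (auto split: tree.splits)

text \<open>The recursion runs from the root, whereas edges attach at the far end of a path; this
  connects the two.\<close>

lemma same_m_snoc:
  "same_m m (p @ [s]) t \<longleftrightarrow>
    same_m m p t \<and> (\<exists>u. subtree_at t (p @ [s]) = Some u \<and> label u \<noteq> None \<and> top_m u = m)"
proof (induction p arbitrary: t)
  case Nil
  then show ?case by (cases t) auto
next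
  case (Cons s' p)
  then show ?case by (cases t) auto
qed

lemma same_m_Comp:
  "min i j = m \<Longrightarrow> {p. same_m m p (Comp i j x y)} =
    insert [] ((#) Lft ` {p. same_m m p x} \<union> (#) Rgt ` {p. same_m m p y})"
proof (intro set_eqI iffI)
  fix p
  assume "min i j = m" "p \<in> {p. same_m m p (Comp i j x y)}"
  then show "p \<in> insert [] ((#) Lft ` {p. same_m m p x} \<union> (#) Rgt ` {p. same_m m p y})"
  proof (cases p)
    case (Cons s q)
    with \<open>p \<in> _\<close> show ?thesis by (cases s) auto
  qed simp
qed auto

text \<open>Connectedness holds because each vertex is joined to \<open>r\<close> along its own
  path, all of whose prefixes also belong to the set.\<close>

lemma m_constant_rooted:
  assumes r: "subtree_at x r = Some t"
  shows "label t \<noteq> None \<Longrightarrow> m_constant x ((@) r ` {p. same_m (top_m t) p t})"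
proof -
  assume t: "label t \<noteq> None"
  define T where "T = (@) r ` {p. same_m (top_m t) p t}"
  define R where "R = {(p, q). p \<in> T \<and> q \<in> T \<and> (edge p q \<or> edge q p)}"
  have T: "\<exists>u. subtree_at x v = Some u \<and> label u \<noteq> None \<and> top_m u = top_m t" if "v \<in> T" for v
    using that same_m_subtree r unfolding T_def by (fastforce simp: subtree_at_append)
  have conn: "(r, r @ p) \<in> R\<^sup>* \<and> (r @ p, r) \<in> R\<^sup>*" if "same_m (top_m t) p t" for p
    using that
  proof (induction p rule: rev_induct)
    case Nil
    then show ?case by simp
  next
    case (snoc s p)
    then have p: "same_m (top_m t) p t" by (simp add: same_m_snoc)
    have "r @ p \<in> T" "(r @ p) @ [s] \<in> T" using p snoc.prems by (auto simp: T_def)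
    then have "(r @ p, r @ p @ [s]) \<in> R" "(r @ p @ [s], r @ p) \<in> R"
      by (auto simp: R_def edge_def)
    then show ?case
      using snoc.IH[OF p] by (meson rtrancl.rtrancl_into_rtrancl converse_rtrancl_into_rtrancl)
  qed
  have "(v, w) \<in> R\<^sup>*" if "v \<in> T" "w \<in> T" for v w
    using that conn unfolding T_def by (auto intro: rtrancl_trans)
  moreover have "T \<noteq> {}" using t by (auto simp: T_def intro!: exI[of _ "[]"])
  ultimately have "connected_vertices T"
    unfolding connected_vertices_def R_def by blast
  moreover have "T \<subseteq> comp_vertices x" using T unfolding comp_vertices_iff subset_iff by blast
  moreover have "m_val x v = top_m t" if "v \<in> T" for v using T[OF that] m_val_eq by metis
  ultimately show ?thesis unfolding m_constant_def T_def by simp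
qed

text \<open>A component is determined by its vertex \<open>r\<close> nearest the root. Walking along
  edges inside \<open>S\<close> from \<open>r\<close> stays within the set rooted there, and
  maximality turns this inclusion into equality.\<close>

lemma m_constant_componentE:
  assumes "m_constant_component x S"
  obtains r t where "subtree_at x r = Some t" "label t \<noteq> None"
    "S = (@) r ` {p. same_m (top_m t) p t}"
proof -
  have S: "S \<subseteq> comp_vertices x" "S \<noteq> {}"
    "\<And>v w. v \<in> S \<Longrightarrow> w \<in> S \<Longrightarrow> edge v w \<Longrightarrow> m_val x v = m_val x w"
    and conn: "\<And>v w. v \<in> S \<Longrightarrow> w \<in> S \<Longrightarrow>
      (v, w) \<in> {(p, q). p \<in> S \<and> q \<in> S \<and> (edge p q \<or> edge q p)}\<^sup>*"
    and max: "\<And>T. m_constant x T \<Longrightarrow> S \<subseteq> T \<Longrightarrow> T = S"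
    using assms unfolding m_constant_component_def m_constant_def connected_vertices_def by blast+
  obtain r where r: "r \<in> S" "\<And>v. v \<in> S \<Longrightarrow> length r \<le> length v"
    using S(2) ex_has_least_nat[of "\<lambda>v. v \<in> S" _ length] by blast
  obtain t where t: "subtree_at x r = Some t" "label t \<noteq> None"
    using S(1) r(1) unfolding comp_vertices_iff subset_iff by blast
  have "v \<in> (@) r ` {p. same_m (top_m t) p t}" if "v \<in> S" for v
    using conn[OF r(1) that]
  proof (induction rule: rtrancl_induct)
    case base
    show ?case using t by (auto intro!: image_eqI[of _ _ "[]"])
  next
    case (step v w)
    then have vw: "v \<in> S" "w \<in> S" and e: "edge v w \<or> edge w v" by auto
    obtain p where p: "v = r @ p" "same_m (top_m t) p t" using step.IH by auto
    from e show ?case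
    proof
      assume "edge v w"
      then obtain s where s: "v = w @ [s]" by (auto simp: edge_def)
      \<comment> \<open>Otherwise the parent \<open>w\<close> would have a shorter address than
        \<open>r\<close>.\<close>
      then have "p \<noteq> []" using r(2)[OF vw(2)] p(1) by auto
      then obtain q s' where q: "p = q @ [s']" by (cases p rule: rev_cases) auto
      then have "w = r @ q" "same_m (top_m t) q t" using s p by (auto simp: same_m_snoc)
      then show ?thesis by auto
    next
      assume edge: "edge w v"
      then obtain s where s: "w = v @ [s]" by (auto simp: edge_def)
      obtain u where u: "subtree_at x w = Some u" "label u \<noteq> None"
        using S(1) vw(2) unfolding comp_vertices_iff subset_iff by blast
      have "subtree_at t (p @ [s]) = Some u" using u(1) t(1) s p(1) by (simp add: subtree_at_append)
      moreover obtain u' where u': "subtree_at t p = Some u'" "top_m u' = top_m t"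
        using same_m_subtree[OF p(2)] by auto
      then have "subtree_at x v = Some u'" using t(1) p(1) by (simp add: subtree_at_append)
      then have "top_m u = top_m t"
        using S(3)[OF vw(2,1) edge] u' m_val_eq u(1) by metis
      ultimately have "same_m (top_m t) (p @ [s]) t" using p(2) u(2) by (auto simp: same_m_snoc)
      then show ?thesis using s p(1) by auto
    qed
  qed
  then have "(@) r ` {p. same_m (top_m t) p t} = S"
    using t by (intro max m_constant_rooted) auto
  with t that show thesis by blast
qed

text \<open>The chain of \<open>whisker_chain\<close> with addresses relative to the root of the
  component, so that it can be built by recursion on the tree.\<close>

definition whisker_path :: "nat \<Rightarrow> nat \<Rightarrow> nat \<Rightarrow> nat \<Rightarrow> 'a tree \<Rightarrow> vertex list \<Rightarrow> bool" where
  "whisker_path i k a b t vs \<longleftrightarrow> 1 \<le> a + b \<and> length vs = a + b \<and> vs ! 0 = [] \<and>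
    (\<forall>l<a. comp_labelled t (vs ! l) i k) \<and>
    (\<forall>l. a \<le> l \<and> l < a + b \<longrightarrow> comp_labelled t (vs ! l) k i) \<and>
    (\<forall>l. Suc l < a + b \<longrightarrow> vs ! Suc l = vs ! l @ [if l < a then Rgt else Lft])"

lemma whisker_path_Rgt:
  assumes "whisker_path i k a b y vs"
  shows "whisker_path i k (Suc a) b (Comp i k x y) ([] # map ((#) Rgt) vs)"
  unfolding whisker_path_def
proof (intro conjI allI impI)
  fix l
  let ?vs = "[] # map ((#) Rgt) vs"
  show "comp_labelled (Comp i k x y) (?vs ! l) i k" if "l < Suc a"
    using that assms by (cases l) (auto simp: whisker_path_def comp_labelled_iff)
  show "comp_labelled (Comp i k x y) (?vs ! l) k i" if "Suc a \<le> l \<and> l < Suc a + b"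
    using that assms by (cases l) (auto simp: whisker_path_def comp_labelled_iff)
  show "?vs ! Suc l = ?vs ! l @ [if l < Suc a then Rgt else Lft]" if "Suc l < Suc a + b"
    using that assms by (cases l) (auto simp: whisker_path_def)
qed (use assms in \<open>auto simp: whisker_path_def\<close>)

text \<open>A new root \<open>Comp k i\<close> can only precede a chain without any
  \<open>Comp i k\<close>, hence the count \<open>0\<close>.\<close>

lemma whisker_path_Lft:
  assumes "whisker_path i k 0 b x vs"
  shows "whisker_path i k 0 (Suc b) (Comp k i x y) ([] # map ((#) Lft) vs)"
  unfolding whisker_path_def
proof (intro conjI allI impI)
  fix l
  let ?vs = "[] # map ((#) Lft) vs"
  show "comp_labelled (Comp k i x y) (?vs ! l) k i" if "0 \<le> l \<and> l < 0 + Suc b"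
    using that assms by (cases l) (auto simp: whisker_path_def comp_labelled_iff)
  show "?vs ! Suc l = ?vs ! l @ [if l < 0 then Rgt else Lft]" if "Suc l < 0 + Suc b"
    using that assms by (cases l) (auto simp: whisker_path_def)
qed (use assms in \<open>auto simp: whisker_path_def\<close>)

text \<open>The strict bound on one input leaves only the other to continue the chain. The clause on
  the label \<open>(k, i)\<close> strengthens the induction so that \<open>whisker_path_Lft\<close>
  applies.\<close>

lemma ex_whisker_path:
  "is_tree n X k t \<Longrightarrow> reduced t \<Longrightarrow> label t \<noteq> None \<Longrightarrow> top_m t = i \<Longrightarrow> i < k \<Longrightarrow>
    \<exists>a b vs. whisker_path i k a b t vs \<and> {p. same_m i p t} = set vs \<and>
      (label t = Some (k, i) \<longrightarrow> a = 0)"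
proof (induction t rule: tree.induct)
  case (Comp p q x y)
  have t: "is_tree n X p x" "is_tree n X q y" "1 \<le> i" "max p q = k" "min p q = i"
    using Comp.prems by (auto simp: is_tree_iff)
  then consider "p = i" "q = k" | "p = k" "q = i" by linarith
  then show ?case
  proof cases
    case 1
    with Comp.prems have r: "reduced y" "top_m x < i" "top_m y \<le> i" by auto
    then have x: "{p. same_m i p x} = {}" using same_m_top by fastforce
    note same = same_m_Comp[OF t(5), of x y, unfolded x]
    show ?thesis
    proof (cases "label y \<noteq> None \<and> top_m y = i")
      case True
      then obtain a b vs where "whisker_path i k a b y vs" "{p. same_m i p y} = set vs"
        using Comp.IH(2) t(2) r Comp.prems(5) 1 by blast
      then show ?thesis
        using whisker_path_Rgt[of i k a b y vs x] same 1 Comp.prems(5)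
        by (intro exI[of _ "Suc a"] exI[of _ b] exI[of _ "[] # map ((#) Rgt) vs"]) auto
    next
      case False
      then have "{p. same_m i p y} = {}" using same_m_top by blast
      then show ?thesis
        using same 1 Comp.prems(5)
        by (intro exI[of _ 1] exI[of _ 0] exI[of _ "[[]]"])
          (auto simp: whisker_path_def comp_labelled_iff)
    qed
  next
    case 2
    with Comp.prems have r: "reduced x" "top_m y < i" "top_m x \<le> i" "label x \<noteq> Some (i, k)" by auto
    then have y: "{p. same_m i p y} = {}" using same_m_top by fastforce
    note same = same_m_Comp[OF t(5), of x y, unfolded y]
    show ?thesis
    proof (cases "label x \<noteq> None \<and> top_m x = i")
      case True
      then have "label x = Some (k, i)"
        using is_tree_label_less[OF t(1), of i] t(3) 2 Comp.prems(5) r by auto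
      then obtain b vs where "whisker_path i k 0 b x vs" "{p. same_m i p x} = set vs"
        using Comp.IH(1) t(1) r Comp.prems(5) True 2 by blast
      then show ?thesis
        using whisker_path_Lft[of i k b x vs y] same 2 Comp.prems(5)
        by (intro exI[of _ 0] exI[of _ "Suc b"] exI[of _ "[] # map ((#) Lft) vs"]) auto
    next
      case False
      then have "{p. same_m i p x} = {}" using same_m_top by blast
      then show ?thesis
        using same 2 Comp.prems(5)
        by (intro exI[of _ 0] exI[of _ 1] exI[of _ "[[]]"])
          (auto simp: whisker_path_def comp_labelled_iff)
    qed
  qed
qed auto

text \<open>A value equal to the dimension makes both indices \<open>k\<close>; right inputs have
  smaller value, so the component is a left spine.\<close>

lemma ex_left_path:
  "is_tree n X k t \<Longrightarrow> reduced t \<Longrightarrow> label t \<noteq> None \<Longrightarrow> top_m t = k \<Longrightarrow>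
    \<exists>vs. vs \<noteq> [] \<and> vs ! 0 = [] \<and> {p. same_m k p t} = set vs \<and>
      (\<forall>v\<in>set vs. comp_labelled t v k k) \<and>
      (\<forall>l. Suc l < length vs \<longrightarrow> vs ! Suc l = vs ! l @ [Lft])"
proof (induction t rule: tree.induct)
  case (Comp p q x y)
  have t: "is_tree n X p x" "1 \<le> k" "p = k" "q = k"
    using Comp.prems by (auto simp: is_tree_iff)
  with Comp.prems have r: "reduced x" "top_m y < k" by auto
  then have y: "{p. same_m k p y} = {}" using same_m_top by fastforce
  have same: "{v. same_m k v (Comp p q x y)} = insert [] ((#) Lft ` {v. same_m k v x})"
    using same_m_Comp[of p q k x y] t y by simp
  show ?case
  proof (cases "label x \<noteq> None \<and> top_m x = k")
    case True
    then obtain vs where vs: "vs \<noteq> []" "vs ! 0 = []" "{p. same_m k p x} = set vs"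
      "\<forall>v\<in>set vs. comp_labelled x v k k"
      "\<And>l. Suc l < length vs \<Longrightarrow> vs ! Suc l = vs ! l @ [Lft]"
      using Comp.IH(1) t r by blast
    let ?vs = "[] # map ((#) Lft) vs"
    have "?vs ! Suc l = ?vs ! l @ [Lft]" if "Suc l < length ?vs" for l
      using that vs by (cases l) auto
    moreover have "\<forall>v\<in>set ?vs. comp_labelled (Comp p q x y) v k k"
      using vs(4) t by (auto simp: comp_labelled_iff)
    ultimately show ?thesis
      using same vs(3) by (intro exI[of _ ?vs]) auto
  next
    case False
    then have "{p. same_m k p x} = {}" using same_m_top by blast
    then show ?thesis
      using same t by (intro exI[of _ "[[]]"]) (auto simp: comp_labelled_iff)
  qed
qed auto

section \<open>From reduced trees to normal forms\<close>

lemma comp_labelled_append: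
  "subtree_at x r = Some t \<Longrightarrow> comp_labelled x (r @ v) i j \<longleftrightarrow> comp_labelled t v i j"
  by (simp add: comp_labelled_iff subtree_at_append)

lemma reduced_component:
  assumes "is_tree n X d x" "reduced x" "m_constant_component x S"
  shows "whisker_chain x S \<or> left_chain x S"
proof -
  obtain r t where r: "subtree_at x r = Some t" "label t \<noteq> None"
    and S: "S = (@) r ` {p. same_m (top_m t) p t}"
    using m_constant_componentE[OF assms(3)] .
  obtain k where t: "is_tree n X k t" "reduced t" using reduced_subtree[OF r(1) assms(2,1)] by blast
  \<comment> \<open>The two kinds of chain are told apart by whether the value at the root of the
    component equals the dimension of the subtree there.\<close>
  show ?thesis
  proof (cases "top_m t = k")
    case True
    then obtain vs where vs: "vs \<noteq> []" "{p. same_m k p t} = set vs"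
      "\<forall>v\<in>set vs. comp_labelled t v k k"
      "\<And>l. Suc l < length vs \<Longrightarrow> vs ! Suc l = vs ! l @ [Lft]"
      using ex_left_path[OF t r(2)] by blast
    have "left_chain x S"
      unfolding left_chain_def
      using vs S True by (intro exI[of _ k] exI[of _ "map ((@) r) vs"])
        (auto simp: comp_labelled_append[OF r(1)])
    then show ?thesis ..
  next
    case False
    then have ik: "top_m t < k" using is_tree_top_m_le[OF t(1)] by simp
    then obtain a b vs where vs: "whisker_path (top_m t) k a b t vs"
      "{p. same_m (top_m t) p t} = set vs"
      using ex_whisker_path[OF t r(2)] by blast
    have "whisker_chain x S"
      unfolding whisker_chain_def
      using vs S ik by (intro exI[of _ "top_m t"] exI[of _ k] exI[of _ a] exI[of _ b]
          exI[of _ "map ((@) r) vs"])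
        (auto simp: comp_labelled_append[OF r(1)] whisker_path_def)
    then show ?thesis ..
  qed
qed

lemma reduced_normal_form:
  assumes x: "is_tree n X d x" "reduced x"
  shows "normal_form x"
proof -
  \<comment> \<open>The order condition and the ban on identities as inputs each concern one vertex
    and one of its inputs, so both can be read off \<open>reduced\<close> locally.\<close>
  have child: "top_m t \<le> m_val x w \<and> \<not> is_ident t"
    if w: "w \<in> comp_vertices x" and v: "subtree_at x (w @ [s]) = Some t" for w s t
  proof -
    obtain u where u: "subtree_at x w = Some u" "label u \<noteq> None"
      using w by (auto simp: comp_vertices_iff)
    then obtain i j y z where c: "u = Comp i j y z" by (cases u) auto
    have t: "t = pick s y z" using v u by (simp add: c subtree_at_append)
    have "reduced_comp u" using reduced_subtree[OF u(1) x(2,1)] by (simp add: c reduced_comp_def)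
    then have "top_m t \<le> min i j \<and> reduced_comp t"
      using reduced_comp_inputs[of i j y z] t by (cases s) (auto simp: c)
    then show ?thesis using m_val_eq[OF u(1)] by (simp add: c reduced_comp_def)
  qed
  have "m_ordered x"
    unfolding m_ordered_def
  proof (intro ballI impI)
    fix v w
    assume vw: "v \<in> comp_vertices x" "w \<in> comp_vertices x" "edge v w"
    then obtain s where s: "v = w @ [s]" by (auto simp: edge_def)
    obtain t where t: "subtree_at x v = Some t" using vw by (auto simp: comp_vertices_iff)
    then show "m_val x v \<le> m_val x w" using child[OF vw(2), of s t] s m_val_eq[OF t] by simp
  qed
  moreover have "\<not> (\<exists>v w. edge v w \<and> u_vertex x v \<and> w \<in> comp_vertices x)"
    using child unfolding edge_def u_vertex_def by fastforce
  ultimately show ?thesis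
    using reduced_component[OF x] unfolding normal_form_def by blast
qed

theorem lemma4p11:
  fixes n d :: nat and C :: "'a precomputad" and x :: "'a tree"
  assumes "computad n n C"
    and "compatible n C d x"
  shows "\<exists>y. compatible n C d y \<and> normal_form y \<and> equiv_tree n C d y x"
proof -
  interpret full_computad n C using assms(1) by unfold_locales
  obtain y where "reduced y" "eqv d x y" using ex_reduced[OF assms(2)] by blast
  then show ?thesis
    using eqv_cmp(2) cmp_tree reduced_normal_form equiv_sym by blast
qed

end
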